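(* Let $P=\{p_1,\dots,p_n\}$ be a finite poset, $K$ a field, and let $\mathcal{W}_P\subset K[\mathbf{x},\mathbf{y},\mathbf{z}]$ be the defining ideal of the Rees algebra $\mathcal{R}(H_P)$, i.e. the kernel of the surjective $K$-algebra homomorphism $\varphi: K[\mathbf{x},\mathbf{y},\mathbf{z}]\to\mathcal{R}(H_P)$ with $\varphi(x_i)=x_i$, $\varphi(y_i)=y_i$, $\varphi(z_I)=u_I t$. Then the reduced Gröbner basis of $\mathcal{W}_P$ with respect to the monomial order $<_{lex}^{\sharp}$ consists of quadratic binomials whose initial monomials are squarefree.
   Context: A poset ideal of a finite poset $P$ is a subset $I\subset P$ such that $x\in I$, $y\in P$, $y\le x$ imply $y\in I$ ($\emptyset$ and $P$ are poset ideals). $\mathcal{J}(P)$ is the set of all poset ideals of $P$, ordered by inclusion. Let $P=\{p_1,\dots,p_n\}$ with $|P|=n$ and $S=K[x_1,\dots,x_n,y_1,\dots,y_n]$, a polynomial ring in $2n$ variables. For $I\in\mathcal{J}(P)$ set $u_I=\bigl(\prod_{p_i\in I}x_i\bigr)\bigl(\prod_{p_i\in P\setminus I}y_i\bigr)$, and let $H_P\subset S$ be the ideal generated by all $u_I$, $I\in\mathcal{J}(P)$. The Rees algebra of $H_P$ is $\mathcal{R}(H_P)=K[\{x_i,y_i\}_{1\le i\le n},\{u_It\}_{I\in\mathcal{J}(P)}]\subset S[t]$. $K[\mathbf{x},\mathbf{y},\mathbf{z}]=K[\{x_i,y_i\}_{1\le i\le n},\{z_I\}_{I\in\mathcal{J}(P)}]$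 is a polynomial ring with one variable $z_I$ for each $I\in\mathcal{J}(P)$. The monomial order $<_{lex}^{\sharp}$ on $K[\mathbf{x},\mathbf{y},\mathbf{z}]$: let $<_{lex}$ be the lexicographic order on $S$ induced by $x_1>\cdots>x_n>y_1>\cdots>y_n$, and let $<^{\sharp}$ be the (graded) reverse lexicographic order on $K[\{z_I\}_{I\in\mathcal{J}(P)}]$ induced by a total ordering of the variables $z_I$ such that $z_I>z_J$ whenever $J<I$ in $\mathcal{J}(P)$ (i.e. $J\subsetneq I$). For monomials $m,m'$ of $S$ and monomials $w,w'$ in the variables $z_I$, put $m w<_{lex}^{\sharp} m' w'$ if either $m<_{lex}m'$, or $m=m'$ and $w<^{\sharp}w'$. *)

theory Defs
  imports "HOL-Library.Poly_Mapping"
begin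

text \<open>
  Monomials in the variables \<open>'v\<close> are finitely supported exponent functions, and polynomials are
  finitely supported functions from monomials to coefficients; addition and multiplication are
  those of HOL-Library's \<open>Poly_Mapping\<close>. The type contains polynomials in all variables of type
  \<open>'v\<close>; the polynomial ring in a given set \<open>V\<close> of variables is the subring \<open>polys V\<close>.
\<close>

type_synonym 'v monom = "'v \<Rightarrow>\<^sub>0 nat"
type_synonym ('v, 'k) mpoly = "('v \<Rightarrow>\<^sub>0 nat) \<Rightarrow>\<^sub>0 'k"

definition const :: "'k::zero \<Rightarrow> ('v, 'k) mpoly"
  where "const c = Poly_Mapping.single 0 c"

definition mon_poly :: "'v monom \<Rightarrow> ('v, 'k::zero_neq_one) mpoly"
  where "mon_poly m = Poly_Mapping.single m 1"

definition var :: "'v \<Rightarrow> ('v, 'k::zero_neq_one) mpoly"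
  where "var v = mon_poly (Poly_Mapping.single v 1)"

definition polys :: "'v set \<Rightarrow> ('v, 'k::zero) mpoly set"
  where "polys V = {f. \<forall>m \<in> Poly_Mapping.keys f. Poly_Mapping.keys m \<subseteq> V}"

definition mon_deg :: "'v monom \<Rightarrow> nat"
  where "mon_deg m = (\<Sum>v\<in>Poly_Mapping.keys m. Poly_Mapping.lookup m v)"

definition mon_dvd :: "'v monom \<Rightarrow> 'v monom \<Rightarrow> bool"
  where "mon_dvd m m' \<longleftrightarrow> (\<exists>k. m' = m + k)"

definition squarefree_mon :: "'v monom \<Rightarrow> bool"
  where "squarefree_mon m \<longleftrightarrow> (\<forall>v. Poly_Mapping.lookup m v \<le> 1)"

definition quadratic_binomial :: "('v, 'k::comm_ring_1) mpoly \<Rightarrow> bool"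
  where "quadratic_binomial f \<longleftrightarrow>
    (\<exists>u v. u \<noteq> v \<and> mon_deg u = 2 \<and> mon_deg v = 2 \<and> f = mon_poly u - mon_poly v)"

text \<open>The \<open>K\<close>-algebra homomorphism sending each variable \<open>v\<close> to \<open>\<sigma> v\<close>.\<close>

definition mon_subst :: "('v \<Rightarrow> ('w, 'k::comm_ring_1) mpoly) \<Rightarrow> 'v monom \<Rightarrow> ('w, 'k) mpoly"
  where "mon_subst \<sigma> m = (\<Prod>v\<in>Poly_Mapping.keys m. \<sigma> v ^ Poly_Mapping.lookup m v)"

definition subst :: "('v \<Rightarrow> ('w, 'k::comm_ring_1) mpoly) \<Rightarrow> ('v, 'k) mpoly \<Rightarrow> ('w, 'k) mpoly"
  where "subst \<sigma> f = (\<Sum>m\<in>Poly_Mapping.keys f. const (Poly_Mapping.lookup f m) * mon_subst \<sigma> m)"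

text \<open>\<open>subalgebra A\<close> is the \<open>K\<close>-subalgebra \<open>K[A]\<close> generated by \<open>A\<close>.\<close>

inductive_set subalgebra :: "('v, 'k::comm_ring_1) mpoly set \<Rightarrow> ('v, 'k) mpoly set"
  for A where
    const: "const c \<in> subalgebra A"
  | gen: "a \<in> A \<Longrightarrow> a \<in> subalgebra A"
  | add: "f \<in> subalgebra A \<Longrightarrow> g \<in> subalgebra A \<Longrightarrow> f + g \<in> subalgebra A"
  | mult: "f \<in> subalgebra A \<Longrightarrow> g \<in> subalgebra A \<Longrightarrow> f * g \<in> subalgebra A"


section \<open>Groebner bases\<close>

text \<open>
  Below, \<open>lt\<close> is a strict monomial order on the monomials in \<open>V\<close>. The ideal generated by \<open>A\<close> is
  taken in \<open>polys V\<close>, i.e. the multipliers only involve variables from \<open>V\<close>.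
\<close>

definition ideal_gen :: "'v set \<Rightarrow> ('v, 'k::comm_ring_1) mpoly set \<Rightarrow> ('v, 'k) mpoly set"
  where "ideal_gen V A =
    {(\<Sum>a\<in>B. q a * a) | B q. finite B \<and> B \<subseteq> A \<and> (\<forall>a\<in>B. q a \<in> polys V)}"

definition in_mon :: "('v monom \<Rightarrow> 'v monom \<Rightarrow> bool) \<Rightarrow> ('v, 'k::zero) mpoly \<Rightarrow> 'v monom"
  where "in_mon lt f =
    (THE m. m \<in> Poly_Mapping.keys f \<and> (\<forall>m'\<in>Poly_Mapping.keys f. m' \<noteq> m \<longrightarrow> lt m' m))"

definition initial_ideal ::
    "'v set \<Rightarrow> ('v monom \<Rightarrow> 'v monom \<Rightarrow> bool) \<Rightarrow> ('v, 'k::comm_ring_1) mpoly set \<Rightarrow> ('v, 'k) mpoly set"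
  where "initial_ideal V lt W = ideal_gen V ((\<lambda>f. mon_poly (in_mon lt f)) ` (W - {0}))"

definition groebner_basis ::
    "'v set \<Rightarrow> ('v monom \<Rightarrow> 'v monom \<Rightarrow> bool) \<Rightarrow>
     ('v, 'k::comm_ring_1) mpoly set \<Rightarrow> ('v, 'k) mpoly set \<Rightarrow> bool"
  where "groebner_basis V lt W G \<longleftrightarrow>
    finite G \<and> G \<subseteq> W - {0} \<and>
    initial_ideal V lt W = ideal_gen V ((\<lambda>g. mon_poly (in_mon lt g)) ` G)"

definition reduced_groebner_basis ::
    "'v set \<Rightarrow> ('v monom \<Rightarrow> 'v monom \<Rightarrow> bool) \<Rightarrow>
     ('v, 'k::comm_ring_1) mpoly set \<Rightarrow> ('v, 'k) mpoly set \<Rightarrow> bool"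
  where "reduced_groebner_basis V lt W G \<longleftrightarrow>
    groebner_basis V lt W G \<and>
    (\<forall>g\<in>G. Poly_Mapping.lookup g (in_mon lt g) = 1) \<and>
    (\<forall>g\<in>G. \<forall>h\<in>G. g \<noteq> h \<longrightarrow> (\<forall>m\<in>Poly_Mapping.keys h. \<not> mon_dvd (in_mon lt g) m))"


section \<open>The Rees algebra of a finite poset\<close>

text \<open>A poset is a carrier \<open>P\<close> with a relation \<open>r\<close>; \<open>(y, x) \<in> r\<close> means \<open>y \<le> x\<close>.\<close>

definition poset_ideal :: "'a set \<Rightarrow> ('a \<times> 'a) set \<Rightarrow> 'a set \<Rightarrow> bool"
  where "poset_ideal P r I \<longleftrightarrow> I \<subseteq> P \<and> (\<forall>x\<in>I. \<forall>y\<in>P. (y, x) \<in> r \<longrightarrow> y \<in> I)"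

definition poset_ideals :: "'a set \<Rightarrow> ('a \<times> 'a) set \<Rightarrow> 'a set set"
  where "poset_ideals P r = {I. poset_ideal P r I}"

text \<open>
  The variables \<open>x\<^sub>i\<close> and \<open>y\<^sub>i\<close> are indexed directly by the poset element \<open>p\<^sub>i\<close>, as \<open>X p\<^sub>i\<close> and
  \<open>Y p\<^sub>i\<close>. The rings \<open>S\<close>, \<open>S[t]\<close> and \<open>K[x,y,z]\<close> are subrings of one type of polynomials.
\<close>

datatype 'a vars = X 'a | Y 'a | Z "'a set" | T

definition xyz_vars :: "'a set \<Rightarrow> ('a \<times> 'a) set \<Rightarrow> 'a vars set"
  where "xyz_vars P r = X ` P \<union> Y ` P \<union> Z ` poset_ideals P r"

definition u_mon :: "'a set \<Rightarrow> 'a set \<Rightarrow> ('a vars, 'k::comm_ring_1) mpoly"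
  where "u_mon P I = (\<Prod>p\<in>I. var (X p)) * (\<Prod>p\<in>P - I. var (Y p))"

definition rees_algebra :: "'a set \<Rightarrow> ('a \<times> 'a) set \<Rightarrow> ('a vars, 'k::comm_ring_1) mpoly set"
  where "rees_algebra P r = subalgebra
    ((\<lambda>p. var (X p)) ` P \<union> (\<lambda>p. var (Y p)) ` P \<union> (\<lambda>I. u_mon P I * var T) ` poset_ideals P r)"

text \<open>The value at \<open>T\<close> is immaterial: \<open>T\<close> does not occur in \<open>K[x,y,z]\<close>.\<close>

fun rees_gen :: "'a set \<Rightarrow> 'a vars \<Rightarrow> ('a vars, 'k::comm_ring_1) mpoly"
  where
    "rees_gen P (X p) = var (X p)"
  | "rees_gen P (Y p) = var (Y p)"
  | "rees_gen P (Z I) = u_mon P I * var T"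
  | "rees_gen P T = 0"

definition rees_map :: "'a set \<Rightarrow> ('a vars, 'k::comm_ring_1) mpoly \<Rightarrow> ('a vars, 'k) mpoly"
  where "rees_map P = subst (rees_gen P)"

definition rees_ideal :: "'a set \<Rightarrow> ('a \<times> 'a) set \<Rightarrow> ('a vars, 'k::comm_ring_1) mpoly set"
  where "rees_ideal P r = {f \<in> polys (xyz_vars P r). rees_map P f = 0}"


section \<open>The monomial order\<close>

text \<open>
  Lists enumerate variables in decreasing order. Both comparisons only look at the exponents of
  the listed variables, i.e. they compare the parts of the monomials in these variables.
\<close>

definition lex_less :: "'v list \<Rightarrow> 'v monom \<Rightarrow> 'v monom \<Rightarrow> bool"
  where "lex_less vs m m' \<longleftrightarrow>
    (\<exists>k < length vs. Poly_Mapping.lookup m (vs ! k) < Poly_Mapping.lookup m' (vs ! k) \<and>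
      (\<forall>j < k. Poly_Mapping.lookup m (vs ! j) = Poly_Mapping.lookup m' (vs ! j)))"

definition degrevlex_less :: "'v list \<Rightarrow> 'v monom \<Rightarrow> 'v monom \<Rightarrow> bool"
  where "degrevlex_less vs w w' \<longleftrightarrow>
    (let d = (\<lambda>m. \<Sum>v\<in>set vs. Poly_Mapping.lookup m v) in
      d w < d w' \<or>
      d w = d w' \<and>
      (\<exists>k < length vs. Poly_Mapping.lookup w (vs ! k) > Poly_Mapping.lookup w' (vs ! k) \<and>
        (\<forall>j. k < j \<and> j < length vs \<longrightarrow>
          Poly_Mapping.lookup w (vs ! j) = Poly_Mapping.lookup w' (vs ! j))))"

text \<open>
  \<open>ps = [p\<^sub>1, \<dots>, p\<^sub>n]\<close> gives \<open>x\<^sub>1 > \<dots> > x\<^sub>n > y\<^sub>1 > \<dots> > y\<^sub>n\<close>, and \<open>Is\<close> enumerates the poset ideals \<open>I\<close>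
  in decreasing order of the variables \<open>z\<^sub>I\<close>.
\<close>

definition lex_sharp_less :: "'a list \<Rightarrow> 'a set list \<Rightarrow> 'a vars monom \<Rightarrow> 'a vars monom \<Rightarrow> bool"
  where "lex_sharp_less ps Is M N \<longleftrightarrow>
    (let xy = map X ps @ map Y ps in
      lex_less xy M N \<or>
      (\<forall>v\<in>set xy. Poly_Mapping.lookup M v = Poly_Mapping.lookup N v) \<and>
      degrevlex_less (map Z Is) M N)"

text \<open>The requirement that \<open>z\<^sub>I > z\<^sub>J\<close> (\<open>I\<close> is listed before \<open>J\<close>) whenever \<open>J \<subset> I\<close>.\<close>

definition admissible_enum :: "'a set \<Rightarrow> ('a \<times> 'a) set \<Rightarrow> 'a set list \<Rightarrow> bool"
  where "admissible_enum P r Is \<longleftrightarrow>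
    distinct Is \<and> set Is = poset_ideals P r \<and>
    (\<forall>i < length Is. \<forall>j < length Is. Is ! j \<subset> Is ! i \<longrightarrow> i < j)"


section \<open>Substitution is a homomorphism, and the Rees map is onto the Rees algebra\<close>

lemma const_mult: "const (a * b) = (const a * const b :: ('v, 'k::comm_ring_1) mpoly)"
  by (simp add: const_def mult_single)

lemma mon_subst_alt:
  assumes "finite A" "Poly_Mapping.keys m \<subseteq> A"
  shows "mon_subst \<sigma> m = (\<Prod>v\<in>A. \<sigma> v ^ Poly_Mapping.lookup m v)"
  unfolding mon_subst_def
  by (rule prod.mono_neutral_left) (use assms in \<open>auto simp: in_keys_iff\<close>)

lemma mon_subst_plus: "mon_subst \<sigma> (m + n) = mon_subst \<sigma> m * mon_subst \<sigma> n"
proof -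
  let ?A = "Poly_Mapping.keys m \<union> Poly_Mapping.keys n"
  have "mon_subst \<sigma> (m + n) = (\<Prod>v\<in>?A. \<sigma> v ^ Poly_Mapping.lookup (m + n) v)"
    by (rule mon_subst_alt) (use keys_add[of m n] in auto)
  also have "\<dots> = (\<Prod>v\<in>?A. \<sigma> v ^ Poly_Mapping.lookup m v) * (\<Prod>v\<in>?A. \<sigma> v ^ Poly_Mapping.lookup n v)"
    by (simp add: lookup_add power_add prod.distrib)
  also have "\<dots> = mon_subst \<sigma> m * mon_subst \<sigma> n"
    by (subst (1 2) mon_subst_alt[where A = ?A]) auto
  finally show ?thesis .
qed

lemma subst_add: "subst \<sigma> (f + g) = subst \<sigma> f + subst \<sigma> g"
  unfolding subst_def
  by (rule setsum_keys_plus_distrib) (auto simp: const_def single_add algebra_simps)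

lemma subst_zero [simp]: "subst \<sigma> 0 = 0"
  by (simp add: subst_def)

lemma subst_sum: "subst \<sigma> (sum h B) = (\<Sum>b\<in>B. subst \<sigma> (h b))"
  by (induction B rule: infinite_finite_induct) (auto simp: subst_add)

lemma subst_single: "subst \<sigma> (Poly_Mapping.single m c) = const c * mon_subst \<sigma> m"
  by (cases "c = 0") (auto simp: subst_def const_def)

lemma poly_expansion:
  "(f :: ('v, 'k::comm_ring_1) mpoly) =
    (\<Sum>m\<in>Poly_Mapping.keys f. Poly_Mapping.single m (Poly_Mapping.lookup f m))"
  by (rule poly_mapping_eqI)
    (auto simp: lookup_sum lookup_single when_def in_keys_iff sum.delta)

lemma subst_mult: "subst \<sigma> (f * g) = subst \<sigma> f * subst \<sigma> g"
proof -
  let ?F = "\<lambda>m. Poly_Mapping.single m (Poly_Mapping.lookup f m)"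
  let ?G = "\<lambda>m. Poly_Mapping.single m (Poly_Mapping.lookup g m)"
  have "subst \<sigma> (f * g) =
      subst \<sigma> ((\<Sum>m\<in>Poly_Mapping.keys f. ?F m) * (\<Sum>n\<in>Poly_Mapping.keys g. ?G n))"
    by (simp flip: poly_expansion)
  also have "\<dots> = (\<Sum>m\<in>Poly_Mapping.keys f. \<Sum>n\<in>Poly_Mapping.keys g. subst \<sigma> (?F m * ?G n))"
    by (simp add: sum_product subst_sum)
  also have "\<dots> = (\<Sum>m\<in>Poly_Mapping.keys f. \<Sum>n\<in>Poly_Mapping.keys g.
      (const (Poly_Mapping.lookup f m) * mon_subst \<sigma> m) *
      (const (Poly_Mapping.lookup g n) * mon_subst \<sigma> n))"
    by (simp add: mult_single subst_single mon_subst_plus const_mult algebra_simps)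
  also have "\<dots> = subst \<sigma> f * subst \<sigma> g"
    by (simp add: subst_def sum_product)
  finally show ?thesis .
qed

lemma subst_const [simp]: "subst \<sigma> (const c) = const c"
  using subst_single[of \<sigma> 0 c] by (simp add: mon_subst_def flip: const_def)

lemma subst_var [simp]: "subst \<sigma> (var v) = \<sigma> v"
  by (simp add: var_def mon_poly_def subst_single mon_subst_def const_def)

lemma polys_add: "f \<in> polys V \<Longrightarrow> g \<in> polys V \<Longrightarrow> f + g \<in> polys V"
  using keys_add[of f g] unfolding polys_def by blast

lemma polys_mult:
  assumes "f \<in> polys V" "g \<in> polys V"
  shows "f * g \<in> polys V"
proof -
  have "Poly_Mapping.keys m \<subseteq> V" if m: "m \<in> Poly_Mapping.keys (f * g)" for m
  proof -
    obtain a b where "m = a + b" "a \<in> Poly_Mapping.keys f" "b \<in> Poly_Mapping.keys g"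
      using keys_mult[of f g] m by blast
    then show ?thesis
      using assms keys_add[of a b] unfolding polys_def by blast
  qed
  then show ?thesis by (auto simp: polys_def)
qed

lemma polys_const: "const c \<in> polys V"
  by (auto simp: polys_def const_def split: if_splits)

lemma polys_var: "v \<in> V \<Longrightarrow> var v \<in> polys V"
  by (auto simp: polys_def var_def mon_poly_def split: if_splits)

lemma subalgebra_sum: "(\<And>b. b \<in> B \<Longrightarrow> h b \<in> subalgebra A) \<Longrightarrow> sum h B \<in> subalgebra A"
proof (induction B rule: infinite_finite_induct)
  case (insert b B)
  then show ?case by (auto intro: subalgebra.add)
qed (use subalgebra.const[of 0 A] in \<open>auto simp: const_def\<close>)

lemma subalgebra_one: "1 \<in> subalgebra A"
  using subalgebra.const[of 1 A] by (simp add: const_def)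

lemma subalgebra_power: "a \<in> subalgebra A \<Longrightarrow> a ^ n \<in> subalgebra A"
  by (induction n) (auto intro: subalgebra.mult subalgebra_one)

lemma subalgebra_prod: "(\<And>b. b \<in> B \<Longrightarrow> h b \<in> subalgebra A) \<Longrightarrow> prod h B \<in> subalgebra A"
  by (induction B rule: infinite_finite_induct) (auto intro: subalgebra.mult subalgebra_one)

lemma subst_image_polys: "subst \<sigma> ` polys V = subalgebra (\<sigma> ` V)"
proof (intro equalityI subsetI)
  fix h assume "h \<in> subst \<sigma> ` polys V"
  then obtain f where f: "f \<in> polys V" "h = subst \<sigma> f" by auto
  show "h \<in> subalgebra (\<sigma> ` V)"
    unfolding f(2) subst_def mon_subst_def
    using f(1)
    by (intro subalgebra_sum subalgebra.mult subalgebra.const subalgebra_prod subalgebra_power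
        subalgebra.gen) (auto simp: polys_def)
next
  fix h assume "h \<in> subalgebra (\<sigma> ` V)"
  then show "h \<in> subst \<sigma> ` polys V"
  proof induction
    case (const c)
    show ?case by (rule image_eqI[of _ _ "const c"]) (auto simp: polys_const)
  next
    case (gen a)
    then obtain v where "v \<in> V" "a = \<sigma> v" by auto
    then show ?case by (intro image_eqI[of _ _ "var v"]) (auto simp: polys_var)
  next
    case (add f g)
    then obtain f' g' where "f' \<in> polys V" "g' \<in> polys V" "f = subst \<sigma> f'" "g = subst \<sigma> g'" by auto
    then show ?case by (intro image_eqI[of _ _ "f' + g'"]) (auto simp: polys_add subst_add)
  next
    case (mult f g)
    then obtain f' g' where "f' \<in> polys V" "g' \<in> polys V" "f = subst \<sigma> f'" "g = subst \<sigma> g'" by auto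
    then show ?case by (intro image_eqI[of _ _ "f' * g'"]) (auto simp: polys_mult subst_mult)
  qed
qed

lemma rees_map_image: "rees_map P ` polys (xyz_vars P r) = rees_algebra P r"
  by (simp add: rees_map_def rees_algebra_def subst_image_polys xyz_vars_def image_Un image_image)

end

theory Submission
  imports Defs
begin

text \<open>
  The binomials \<open>x\<^sub>p z\<^sub>I - y\<^sub>p z\<^sub>N\<close> with \<open>N = I \<union> {p}\<close> and \<open>z\<^sub>I z\<^sub>J - z\<^sub>U z\<^sub>M\<close> with \<open>I\<close>, \<open>J\<close> incomparable,
  \<open>U = I \<union> J\<close>, \<open>M = I \<inter> J\<close>, lie in the ideal, and their first terms are the initial ones. They form a
  Groebner basis because every fibre of the Rees map on monomials contains at most one standard
  monomial, i.e. one divisible by none of these initial terms, which is then the smallest monomial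
  of the fibre, so that no element of the ideal has a standard initial monomial. For the uniqueness,
  the \<open>z\<close>-part of a standard monomial is a chain with multiplicities, determined by the numbers
  \<open>c\<^sub>p\<close> of chain members containing \<open>p\<close>. If two standard monomials in a fibre have different \<open>c\<close>, take
  \<open>p\<close> minimal in the poset where they differ: the monomial with the smaller \<open>c\<^sub>p\<close> is divisible by
  \<open>x\<^sub>p\<close> and has a chain member to which \<open>p\<close> can be added.
\<close>

section \<open>Monomials as exponent functions, and divisibility\<close>

lemma lookup_mon_poly: "Poly_Mapping.lookup (mon_poly m) n = (if m = n then 1 else 0)"
  by (simp add: mon_poly_def lookup_single when_def)

lemma keys_mon_poly [simp]:
  "Poly_Mapping.keys (mon_poly m :: ('v, 'k::zero_neq_one) mpoly) = {m}"
  by (simp add: mon_poly_def)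

lemma mon_poly_add: "mon_poly (m + n) = (mon_poly m * mon_poly n :: ('v, 'k::comm_ring_1) mpoly)"
  by (simp add: mon_poly_def mult_single)

lemma keys_plus_nat: "Poly_Mapping.keys (m + n :: 'v monom) = Poly_Mapping.keys m \<union> Poly_Mapping.keys n"
  by (auto simp: in_keys_iff lookup_add)

lemma mon_dvd_iff: "mon_dvd m n \<longleftrightarrow> (\<forall>v. Poly_Mapping.lookup m v \<le> Poly_Mapping.lookup n v)"
proof
  assume "\<forall>v. Poly_Mapping.lookup m v \<le> Poly_Mapping.lookup n v"
  then have "n = m + (n - m)"
    by (intro poly_mapping_eqI) (simp add: lookup_add lookup_minus)
  then show "mon_dvd m n" unfolding mon_dvd_def by blast
qed (auto simp: mon_dvd_def lookup_add)

lemma mon_dvd_trans: "mon_dvd l m \<Longrightarrow> mon_dvd m n \<Longrightarrow> mon_dvd l n"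
  using order_trans unfolding mon_dvd_iff by blast

lemma mon_dvd_antisym: "mon_dvd m n \<Longrightarrow> mon_dvd n m \<Longrightarrow> m = n"
  by (intro poly_mapping_eqI) (auto simp: mon_dvd_iff intro: antisym)

section \<open>Uniqueness of reduced Groebner bases\<close>

lemma ideal_gen_zero: "0 \<in> ideal_gen V A"
  unfolding ideal_gen_def by (auto intro!: exI[of _ "{}"])

lemma ideal_gen_superset: "a \<in> A \<Longrightarrow> a \<in> ideal_gen V A"
  unfolding ideal_gen_def
  by (auto intro!: exI[of _ "{a}"] exI[of _ "\<lambda>_. 1"] simp: polys_def)

lemma ideal_gen_add:
  assumes "f \<in> ideal_gen V A" "g \<in> ideal_gen V A"
  shows "f + g \<in> ideal_gen V A"
proof -
  obtain B p where B: "finite B" "B \<subseteq> A" "\<forall>a\<in>B. p a \<in> polys V" "f = (\<Sum>a\<in>B. p a * a)"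
    using assms(1) unfolding ideal_gen_def by blast
  obtain C q where C: "finite C" "C \<subseteq> A" "\<forall>a\<in>C. q a \<in> polys V" "g = (\<Sum>a\<in>C. q a * a)"
    using assms(2) unfolding ideal_gen_def by blast
  \<comment> \<open>Extending both multiplier functions by zero puts the two sums over the common
    index set \<open>B \<union> C\<close>.\<close>
  define p' where "p' a = (if a \<in> B then p a else 0)" for a
  define q' where "q' a = (if a \<in> C then q a else 0)" for a
  have "f = (\<Sum>a\<in>B \<union> C. p' a * a)" "g = (\<Sum>a\<in>B \<union> C. q' a * a)"
    unfolding B(4) C(4) p'_def q'_def
    by (rule sum.mono_neutral_cong_left; use B C in auto)+
  then have "f + g = (\<Sum>a\<in>B \<union> C. (p' a + q' a) * a)"
    by (simp add: sum.distrib distrib_right)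
  moreover have "0 \<in> polys V" by (simp add: polys_def)
  then have "\<forall>a\<in>B \<union> C. p' a + q' a \<in> polys V"
    using B C by (auto simp: p'_def q'_def intro: polys_add)
  ultimately show ?thesis
    unfolding ideal_gen_def using B C by (auto intro!: exI[of _ "B \<union> C"])
qed

lemma ideal_gen_mult:
  assumes "f \<in> ideal_gen V A" "h \<in> polys V"
  shows "h * f \<in> ideal_gen V A"
proof -
  obtain B p where B: "finite B" "B \<subseteq> A" "\<forall>a\<in>B. p a \<in> polys V" "f = (\<Sum>a\<in>B. p a * a)"
    using assms(1) unfolding ideal_gen_def by blast
  have "h * f = (\<Sum>a\<in>B. (h * p a) * a)"
    by (simp add: B(4) sum_distrib_left mult.assoc)
  then show ?thesis
    unfolding ideal_gen_def using B assms(2)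
    by (auto intro!: exI[of _ B] exI[of _ "\<lambda>a. h * p a"] polys_mult)
qed

lemma ideal_gen_sum: "(\<And>b. b \<in> B \<Longrightarrow> h b \<in> ideal_gen V A) \<Longrightarrow> sum h B \<in> ideal_gen V A"
  by (induction B rule: infinite_finite_induct) (auto intro: ideal_gen_add ideal_gen_zero)

lemma ideal_gen_subset: "A \<subseteq> ideal_gen V B \<Longrightarrow> ideal_gen V A \<subseteq> ideal_gen V B"
  by (subst (1) ideal_gen_def) (auto intro!: ideal_gen_sum ideal_gen_mult)

text \<open>A monomial occurring in a combination of monomials occurs already in one product
  \<open>q b * b\<close>, all of whose monomials are multiples of the monomial
  \<open>b\<close>.\<close>

lemma monomial_in_ideal_gen:
  assumes "mon_poly m \<in> ideal_gen V (mon_poly ` A :: ('v, 'k::comm_ring_1) mpoly set)"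
  shows "\<exists>a\<in>A. mon_dvd a m"
proof -
  obtain B q where B: "B \<subseteq> mon_poly ` A" and eq: "(mon_poly m :: ('v, 'k) mpoly) = (\<Sum>b\<in>B. q b * b)"
    using assms unfolding ideal_gen_def by blast
  have "m \<in> Poly_Mapping.keys (\<Sum>b\<in>B. q b * b)"
    unfolding eq[symmetric] by simp
  then obtain b where b: "b \<in> B" "m \<in> Poly_Mapping.keys (q b * b)"
    using keys_sum[of "\<lambda>b. q b * b" B] by blast
  obtain a where a: "a \<in> A" "b = mon_poly a" using B b(1) by blast
  obtain k where "m = k + a"
    using keys_mult[of "q b" b] b(2) unfolding a(2) by auto
  then show ?thesis using a(1) by (auto simp: mon_dvd_def add.commute)
qed

text \<open>Totality and positivity are confined to monomials in \<open>V\<close> because an order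
  such as \<open>lex_sharp_less\<close> sees only the exponents of the listed variables.\<close>

locale monomial_order =
  fixes V :: "'v set" and lt :: "'v monom \<Rightarrow> 'v monom \<Rightarrow> bool"
  assumes irrefl: "\<not> lt m m"
    and trans: "lt l m \<Longrightarrow> lt m n \<Longrightarrow> lt l n"
    and total: "Poly_Mapping.keys m \<subseteq> V \<Longrightarrow> Poly_Mapping.keys n \<subseteq> V \<Longrightarrow> m \<noteq> n \<Longrightarrow> lt m n \<or> lt n m"
    and add_mono: "lt m n \<Longrightarrow> lt (m + k) (n + k)"
    and pos: "Poly_Mapping.keys k \<subseteq> V \<Longrightarrow> k \<noteq> 0 \<Longrightarrow> lt 0 k"
begin

lemma transp_asymp: "transp_on A lt" "asymp_on A lt"
  using trans irrefl by (auto intro!: transp_onI asymp_onI)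

lemma in_mon_eqI:
  assumes "m \<in> Poly_Mapping.keys f" "\<And>n. n \<in> Poly_Mapping.keys f \<Longrightarrow> n \<noteq> m \<Longrightarrow> lt n m"
  shows "in_mon lt f = m"
  unfolding in_mon_def
proof (rule the_equality)
  fix n assume n: "n \<in> Poly_Mapping.keys f \<and> (\<forall>m\<in>Poly_Mapping.keys f. m \<noteq> n \<longrightarrow> lt m n)"
  show "n = m"
    using n assms trans[of m n m] irrefl[of m] by metis
qed (use assms in auto)

lemma
  assumes "f \<in> polys V" "f \<noteq> 0"
  shows in_mon_in_keys: "in_mon lt f \<in> Poly_Mapping.keys f"
    and less_in_mon: "\<And>n. n \<in> Poly_Mapping.keys f \<Longrightarrow> n \<noteq> in_mon lt f \<Longrightarrow> lt n (in_mon lt f)"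
proof -
  obtain m where m: "m \<in> Poly_Mapping.keys f" "\<forall>n\<in>Poly_Mapping.keys f. n \<noteq> m \<longrightarrow> \<not> lt m n"
    using Finite_Set.bex_max_element[of "Poly_Mapping.keys f" lt] transp_asymp assms(2)
    by auto
  have max: "lt n m" if "n \<in> Poly_Mapping.keys f" "n \<noteq> m" for n
    using total[of n m] m that assms(1) by (auto simp: polys_def)
  have "in_mon lt f = m" using m(1) max by (rule in_mon_eqI)
  then show "in_mon lt f \<in> Poly_Mapping.keys f"
    and "\<And>n. n \<in> Poly_Mapping.keys f \<Longrightarrow> n \<noteq> in_mon lt f \<Longrightarrow> lt n (in_mon lt f)"
    using m(1) max by auto
qed

text \<open>The cofactor of a proper divisor is above \<open>0\<close>; adding the divisor to both
  sides puts the multiple above it.\<close>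

lemma mon_dvd_not_less:
  assumes "mon_dvd m n" "Poly_Mapping.keys n \<subseteq> V"
  shows "\<not> lt n m"
proof -
  obtain k where k: "n = m + k" using assms(1) by (auto simp: mon_dvd_def)
  show ?thesis
  proof (cases "k = 0")
    case True
    then show ?thesis using irrefl by (simp add: k)
  next
    case False
    then have "lt 0 k" using pos assms(2) by (simp add: k keys_plus_nat)
    then have "lt m n" using add_mono[of 0 k m] by (simp add: k add.commute)
    then show ?thesis using trans irrefl by blast
  qed
qed

text \<open>A monomial lies in a monomial ideal exactly when a generator divides it, which turns
  equality of initial ideals into a divisibility criterion. Both the uniqueness proof and the final
  construction work with this criterion.\<close>

lemma groebner_basis_iff:
  fixes W :: "('v, 'k::comm_ring_1) mpoly set"
  assumes "W \<subseteq> polys V"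
  shows "groebner_basis V lt W G \<longleftrightarrow> finite G \<and> G \<subseteq> W - {0} \<and>
    (\<forall>f\<in>W - {0}. \<exists>g\<in>G. mon_dvd (in_mon lt g) (in_mon lt f))" (is "?L \<longleftrightarrow> ?R")
proof
  assume L: ?L
  have "\<exists>g\<in>G. mon_dvd (in_mon lt g) (in_mon lt f)" if f: "f \<in> W - {0}" for f
  proof -
    have "mon_poly (in_mon lt f) \<in> initial_ideal V lt W"
      unfolding initial_ideal_def using f by (intro ideal_gen_superset) blast
    then have "mon_poly (in_mon lt f) \<in> ideal_gen V (mon_poly ` in_mon lt ` G :: ('v, 'k) mpoly set)"
      using L by (simp add: groebner_basis_def image_image)
    then show ?thesis using monomial_in_ideal_gen by blast
  qed
  then show ?R using L by (simp add: groebner_basis_def)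
next
  assume R: ?R
  let ?I = "ideal_gen V ((\<lambda>g. mon_poly (in_mon lt g)) ` G) :: ('v, 'k) mpoly set"
  have "mon_poly (in_mon lt f) \<in> ?I" if f: "f \<in> W - {0}" for f
  proof -
    obtain g k where g: "g \<in> G" "in_mon lt f = in_mon lt g + k"
      using R f unfolding mon_dvd_def by blast
    \<comment> \<open>The cofactor \<open>k\<close> must be a legal multiplier; its variables are
      among those of \<open>in_mon lt f\<close>, hence in \<open>V\<close>.\<close>
    have "in_mon lt f \<in> Poly_Mapping.keys f" using f assms by (intro in_mon_in_keys) auto
    then have "Poly_Mapping.keys (in_mon lt f) \<subseteq> V" using f assms by (auto simp: polys_def)
    then have "(mon_poly k :: ('v, 'k) mpoly) \<in> polys V"
      by (simp add: g(2) keys_plus_nat polys_def)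
    then have "mon_poly k * mon_poly (in_mon lt g) \<in> ?I"
      using g(1) by (intro ideal_gen_mult ideal_gen_superset) auto
    then show ?thesis by (simp add: g(2) mon_poly_add mult.commute)
  qed
  then have "initial_ideal V lt W \<subseteq> ?I"
    unfolding initial_ideal_def by (intro ideal_gen_subset) blast
  moreover have "?I \<subseteq> initial_ideal V lt W"
    unfolding initial_ideal_def using R
    by (intro ideal_gen_subset) (auto intro!: ideal_gen_superset)
  ultimately show ?L using R by (auto simp: groebner_basis_def)
qed

text \<open>Elements of \<open>G\<close> and \<open>H\<close> with the same initial monomial must
  coincide, since otherwise the initial monomial of their difference would be a non-initial monomial
  of one of them. Applied in both directions this gives uniqueness.\<close>

lemma reduced_groebner_basis_subset:
  fixes W :: "('v, 'k::comm_ring_1) mpoly set"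
  assumes W: "W \<subseteq> polys V" "\<And>f g. f \<in> W \<Longrightarrow> g \<in> W \<Longrightarrow> f - g \<in> W"
    and G: "reduced_groebner_basis V lt W G" and H: "reduced_groebner_basis V lt W H"
  shows "G \<subseteq> H"
proof
  \<comment> \<open>A non-initial monomial of a basis element is never initial for an element of
    \<open>W\<close>: it would be divisible by the initial monomial of some basis element. That
    element is not \<open>g\<close>, whose initial monomial is larger, so reducedness is
    violated.\<close>
  have tail: False
    if "reduced_groebner_basis V lt W F" "g \<in> F" "f \<in> W - {0}"
      "in_mon lt f \<in> Poly_Mapping.keys g" "in_mon lt f \<noteq> in_mon lt g" for F f g
  proof -
    have F: "F \<subseteq> W - {0}" "\<exists>h\<in>F. mon_dvd (in_mon lt h) (in_mon lt f)"
      using that(1,3) W(1) by (simp_all add: reduced_groebner_basis_def groebner_basis_iff)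
    have "g \<in> polys V" "g \<noteq> 0" using that(2) F W by auto
    then have "lt (in_mon lt f) (in_mon lt g)" "Poly_Mapping.keys (in_mon lt f) \<subseteq> V"
      using less_in_mon that(4,5) by (auto simp: polys_def)
    then have "\<not> mon_dvd (in_mon lt g) (in_mon lt f)" using mon_dvd_not_less by blast
    then show False
      using F(2) that(1,2,4) unfolding reduced_groebner_basis_def by metis
  qed
  fix g assume g: "g \<in> G"
  have GW: "G \<subseteq> W - {0}" "\<forall>f\<in>W - {0}. \<exists>h\<in>G. mon_dvd (in_mon lt h) (in_mon lt f)"
    using G W(1) by (simp_all add: reduced_groebner_basis_def groebner_basis_iff)
  have HW: "H \<subseteq> W - {0}" "\<forall>f\<in>W - {0}. \<exists>h\<in>H. mon_dvd (in_mon lt h) (in_mon lt f)"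
    using H W(1) by (simp_all add: reduced_groebner_basis_def groebner_basis_iff)
  \<comment> \<open>Passing from \<open>G\<close> to \<open>H\<close> and back gives a divisor of
    \<open>in_mon lt g\<close> coming from \<open>G\<close>, and reducedness forces it to come from
    \<open>g\<close>. So \<open>g\<close> and \<open>h\<close> share their initial monomial.\<close>
  obtain h where h: "h \<in> H" "mon_dvd (in_mon lt h) (in_mon lt g)" using g GW HW by blast
  obtain g' where g': "g' \<in> G" "mon_dvd (in_mon lt g') (in_mon lt h)" using h GW HW by blast
  have "in_mon lt g \<in> Poly_Mapping.keys g" using g GW W by (intro in_mon_in_keys) auto
  then have "g' = g"
    using G g g'(1) mon_dvd_trans[OF g'(2) h(2)] unfolding reduced_groebner_basis_def by blast
  then have eq: "in_mon lt g = in_mon lt h" using mon_dvd_antisym g'(2) h(2) by blast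
  show "g \<in> H"
  proof (rule ccontr)
    assume "g \<notin> H"
    then have f: "g - h \<in> W - {0}" using W(2)[of g h] g h(1) GW(1) HW(1) by auto
    then have "in_mon lt (g - h) \<in> Poly_Mapping.keys (g - h)"
      using W(1) by (intro in_mon_in_keys) auto
    \<comment> \<open>Both initial coefficients are 1 and cancel.\<close>
    moreover have "Poly_Mapping.lookup (g - h) (in_mon lt g) = 0"
      using G H g h eq by (auto simp: reduced_groebner_basis_def lookup_minus)
    ultimately have "in_mon lt (g - h) \<noteq> in_mon lt g"
      "in_mon lt (g - h) \<in> Poly_Mapping.keys g \<union> Poly_Mapping.keys h"
      by (auto simp: in_keys_iff lookup_minus)
    then show False using tail[OF G g f] tail[OF H h(1) f] eq by auto
  qed
qed

end

section \<open>The order is a monomial order\<close>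

lemma lex_less_irrefl: "\<not> lex_less vs m m"
  by (auto simp: lex_less_def)

lemma lex_less_trans:
  assumes "lex_less vs l m" "lex_less vs m n"
  shows "lex_less vs l n"
proof -
  obtain i where i: "i < length vs" "Poly_Mapping.lookup l (vs ! i) < Poly_Mapping.lookup m (vs ! i)"
    "\<forall>j<i. Poly_Mapping.lookup l (vs ! j) = Poly_Mapping.lookup m (vs ! j)"
    using assms(1) unfolding lex_less_def by blast
  obtain k where k: "k < length vs" "Poly_Mapping.lookup m (vs ! k) < Poly_Mapping.lookup n (vs ! k)"
    "\<forall>j<k. Poly_Mapping.lookup m (vs ! j) = Poly_Mapping.lookup n (vs ! j)"
    using assms(2) unfolding lex_less_def by blast
  show ?thesis
    unfolding lex_less_def
    using i k by (intro exI[of _ "min i k"]) (cases i k rule: linorder_cases; force)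
qed

lemma lex_less_total:
  assumes "v \<in> set vs" "Poly_Mapping.lookup m v \<noteq> Poly_Mapping.lookup n v"
  shows "lex_less vs m n \<or> lex_less vs n m"
proof -
  let ?D = "\<lambda>k. k < length vs \<and> Poly_Mapping.lookup m (vs ! k) \<noteq> Poly_Mapping.lookup n (vs ! k)"
  have "\<exists>k. ?D k" using assms by (metis in_set_conv_nth)
  then obtain k where k: "?D k" "\<forall>j<k. \<not> ?D j" using exists_least_iff[of ?D] by blast
  then have "\<forall>j<k. Poly_Mapping.lookup m (vs ! j) = Poly_Mapping.lookup n (vs ! j)"
    using less_trans by blast
  then show ?thesis
    using k unfolding lex_less_def by (metis linorder_neqE_nat)
qed

lemma lex_less_add: "lex_less vs (m + k) (n + k) \<longleftrightarrow> lex_less vs m n"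
  by (simp add: lex_less_def lookup_add)

lemma lex_less_cong:
  assumes "\<And>v. v \<in> set vs \<Longrightarrow> Poly_Mapping.lookup m v = Poly_Mapping.lookup m' v"
    and "\<And>v. v \<in> set vs \<Longrightarrow> Poly_Mapping.lookup n v = Poly_Mapping.lookup n' v"
  shows "lex_less vs m n \<longleftrightarrow> lex_less vs m' n'"
  unfolding lex_less_def using assms by (intro ex_cong1 conj_cong) auto

text \<open>Reading the list backwards turns the last differing position into the first, and the
  larger exponent there marks the smaller monomial; hence the swapped arguments. The lexicographic
  lemmas then serve for both orders.\<close>

lemma degrevlex_less_iff:
  "degrevlex_less vs m n \<longleftrightarrow>
    (\<Sum>v\<in>set vs. Poly_Mapping.lookup m v) < (\<Sum>v\<in>set vs. Poly_Mapping.lookup n v) \<or>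
    (\<Sum>v\<in>set vs. Poly_Mapping.lookup m v) = (\<Sum>v\<in>set vs. Poly_Mapping.lookup n v) \<and>
    lex_less (rev vs) n m"
proof -
  let ?l = "length vs"
  have flip: "?l - Suc (?l - Suc k) = k" "?l - Suc k < ?l" if "k < ?l" for k
    using that by auto
  have "(\<exists>k<?l. Poly_Mapping.lookup m (vs ! k) > Poly_Mapping.lookup n (vs ! k) \<and>
      (\<forall>j. k < j \<and> j < ?l \<longrightarrow> Poly_Mapping.lookup m (vs ! j) = Poly_Mapping.lookup n (vs ! j)))
    \<longleftrightarrow> lex_less (rev vs) n m" (is "?L \<longleftrightarrow> ?R")
  proof
    assume ?L
    then obtain k where k: "k < ?l" "Poly_Mapping.lookup m (vs ! k) > Poly_Mapping.lookup n (vs ! k)"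
      "\<And>j. k < j \<Longrightarrow> j < ?l \<Longrightarrow> Poly_Mapping.lookup m (vs ! j) = Poly_Mapping.lookup n (vs ! j)"
      by blast
    show ?R
      unfolding lex_less_def
    proof (intro exI[of _ "?l - Suc k"] conjI allI impI)
      fix j assume "j < ?l - Suc k"
      then show "Poly_Mapping.lookup n (rev vs ! j) = Poly_Mapping.lookup m (rev vs ! j)"
        using k(1) k(3)[of "?l - Suc j"] by (simp add: rev_nth)
    qed (use k flip[of k] in \<open>auto simp: rev_nth\<close>)
  next
    assume ?R
    then obtain k where k: "k < ?l" "Poly_Mapping.lookup n (rev vs ! k) < Poly_Mapping.lookup m (rev vs ! k)"
      "\<And>j. j < k \<Longrightarrow> Poly_Mapping.lookup n (rev vs ! j) = Poly_Mapping.lookup m (rev vs ! j)"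
      unfolding lex_less_def by auto
    show ?L
    proof (intro exI[of _ "?l - Suc k"] conjI allI impI)
      fix j assume j: "?l - Suc k < j \<and> j < ?l"
      then have "?l - Suc j < k" using k(1) by arith
      with j show "Poly_Mapping.lookup m (vs ! j) = Poly_Mapping.lookup n (vs ! j)"
        using k(1) k(3)[of "?l - Suc j"] by (simp add: rev_nth)
    qed (use k in \<open>auto simp: rev_nth\<close>)
  qed
  then show ?thesis unfolding degrevlex_less_def Let_def by simp
qed

lemma monomial_order_lex_sharp:
  assumes "set ps = P" "set Is = poset_ideals P r"
  shows "monomial_order (xyz_vars P r) (lex_sharp_less ps Is)"
proof -
  define xy where "xy = map X ps @ map Y ps"
  define zs where "zs = map Z Is"
  define d where "d m = (\<Sum>v\<in>set zs. Poly_Mapping.lookup m v)" for m :: "'a vars monom"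
  define ag where "ag m n \<longleftrightarrow> (\<forall>v\<in>set xy. Poly_Mapping.lookup m v = Poly_Mapping.lookup n v)"
    for m n :: "'a vars monom"
  have lt: "lex_sharp_less ps Is m n \<longleftrightarrow>
      lex_less xy m n \<or> ag m n \<and> (d m < d n \<or> d m = d n \<and> lex_less (rev zs) n m)" for m n
    unfolding lex_sharp_less_def degrevlex_less_iff Let_def xy_def zs_def d_def ag_def by simp
  have V: "xyz_vars P r = set xy \<union> set zs"
    using assms by (simp add: xyz_vars_def xy_def zs_def)
  have d_add: "d (m + n) = d m + d n" for m n
    by (simp add: d_def lookup_add sum.distrib)
  have ag_add: "ag (m + k) (n + k) \<longleftrightarrow> ag m n" for m n k
    by (simp add: ag_def lookup_add)
  \<comment> \<open>Equal \<open>x\<close> and \<open>y\<close> parts can be exchanged inside a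
    lexicographic comparison, so transitivity becomes a case split on which component
    decides.\<close>
  have ag_lex: "lex_less xy l m \<Longrightarrow> ag m n \<Longrightarrow> lex_less xy l n"
    "ag l m \<Longrightarrow> lex_less xy m n \<Longrightarrow> lex_less xy l n" for l m n
    using lex_less_cong[of xy l l m n] lex_less_cong[of xy l m n n] by (auto simp: ag_def)
  have ag_trans: "ag l m \<Longrightarrow> ag m n \<Longrightarrow> ag l n" for l m n by (auto simp: ag_def)
  show ?thesis
  proof
    show "\<not> lex_sharp_less ps Is m m" for m
      by (simp add: lt lex_less_irrefl)
  next
    fix l m n assume "lex_sharp_less ps Is l m" "lex_sharp_less ps Is m n"
    then show "lex_sharp_less ps Is l n"
      unfolding lt
      by (elim disjE conjE)
        (auto dest: lex_less_trans ag_lex ag_trans)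
  next
    fix m n :: "'a vars monom"
    assume k: "Poly_Mapping.keys m \<subseteq> xyz_vars P r" "Poly_Mapping.keys n \<subseteq> xyz_vars P r"
      and "m \<noteq> n"
    then obtain v where v: "Poly_Mapping.lookup m v \<noteq> Poly_Mapping.lookup n v"
      by (metis poly_mapping_eqI)
    then have "v \<in> set xy \<union> set zs" using k V by (metis UnE in_keys_iff subsetD)
    show "lex_sharp_less ps Is m n \<or> lex_sharp_less ps Is n m"
    proof (cases "ag m n")
      case True
      then have "v \<in> set (rev zs)" using v \<open>v \<in> set xy \<union> set zs\<close> by (auto simp: ag_def)
      then have "lex_less (rev zs) m n \<or> lex_less (rev zs) n m" using v by (intro lex_less_total)
      moreover have "ag n m" using True by (simp add: ag_def)
      ultimately show ?thesis using True unfolding lt by (cases "d m" "d n" rule: linorder_cases) auto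
    next
      case False
      then obtain w where "w \<in> set xy" "Poly_Mapping.lookup m w \<noteq> Poly_Mapping.lookup n w"
        by (auto simp: ag_def)
      then show ?thesis using lex_less_total[of w xy m n] by (auto simp: lt)
    qed
  next
    fix m n k assume "lex_sharp_less ps Is m n"
    then show "lex_sharp_less ps Is (m + k) (n + k)"
      by (auto simp: lt lex_less_add ag_add d_add)
  next
    fix k :: "'a vars monom"
    assume k: "Poly_Mapping.keys k \<subseteq> xyz_vars P r" "k \<noteq> 0"
    show "lex_sharp_less ps Is 0 k"
    proof (cases "ag 0 k")
      case True
      \<comment> \<open>With trivial \<open>x\<close> and \<open>y\<close> part, \<open>k\<close>
        contains some \<open>z\<close> variable, so its \<open>z\<close> degree exceeds that of
        \<open>0\<close>.\<close>
      obtain v where v: "v \<in> Poly_Mapping.keys k" using k(2) by (metis in_keys_iff lookup_zero poly_mapping_eqI)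
      moreover have "v \<notin> set xy" using v True by (auto simp: ag_def in_keys_iff)
      ultimately have "v \<in> set zs" using k(1) V by blast
      then have "d k \<noteq> 0" using v by (auto simp: d_def in_keys_iff)
      moreover have "d 0 = 0" by (simp add: d_def)
      ultimately show ?thesis using True by (simp add: lt)
    next
      case False
      then obtain w where "w \<in> set xy" "Poly_Mapping.lookup 0 w \<noteq> Poly_Mapping.lookup k w"
        by (auto simp: ag_def)
      moreover have "\<not> lex_less xy k 0" by (simp add: lex_less_def)
      ultimately show ?thesis using lex_less_total[of w xy 0 k] by (auto simp: lt)
    qed
  qed
qed

section \<open>The Rees map on monomials\<close>

text \<open>Exponents of the images of the variables. The value at \<open>T\<close> is a dummy:
  \<open>rees_gen\<close> sends \<open>T\<close> to the polynomial 0, which is no monomial, so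
  \<open>T\<close> is excluded when the two are related.\<close>

fun gen_mon :: "'a set \<Rightarrow> 'a vars \<Rightarrow> 'a vars monom" where
  "gen_mon P (X p) = Poly_Mapping.single (X p) 1"
| "gen_mon P (Y p) = Poly_Mapping.single (Y p) 1"
| "gen_mon P (Z I) = (\<Sum>p\<in>I. Poly_Mapping.single (X p) 1) +
    (\<Sum>p\<in>P - I. Poly_Mapping.single (Y p) 1) + Poly_Mapping.single T 1"
| "gen_mon P T = 0"

text \<open>The inner sum has constant terms and stands for the multiple of
  \<open>gen_mon P v\<close> by the exponent of \<open>v\<close>; under \<open>mon_poly\<close> it
  becomes a power.\<close>

definition rees_mon :: "'a set \<Rightarrow> 'a vars monom \<Rightarrow> 'a vars monom"
  where "rees_mon P m = (\<Sum>v\<in>Poly_Mapping.keys m. \<Sum>i<Poly_Mapping.lookup m v. gen_mon P v)"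

lemma mon_poly_zero: "mon_poly 0 = 1"
  by (simp add: mon_poly_def)

lemma mon_poly_sum:
  "mon_poly (sum h A) = (\<Prod>a\<in>A. mon_poly (h a) :: ('v, 'k::comm_ring_1) mpoly)"
  by (induction A rule: infinite_finite_induct) (simp_all add: mon_poly_zero mon_poly_add)

lemma rees_gen_eq_mon_poly:
  "v \<noteq> T \<Longrightarrow> rees_gen P v = (mon_poly (gen_mon P v) :: ('a vars, 'k::comm_ring_1) mpoly)"
  by (cases v) (simp_all add: mon_poly_add mon_poly_sum u_mon_def var_def)

lemma mon_subst_rees_gen:
  assumes "T \<notin> Poly_Mapping.keys m"
  shows "mon_subst (rees_gen P) m = (mon_poly (rees_mon P m) :: ('a vars, 'k::comm_ring_1) mpoly)"
proof -
  have "rees_gen P v = (mon_poly (gen_mon P v) :: ('a vars, 'k) mpoly)" if "v \<in> Poly_Mapping.keys m" for v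
    using assms that by (metis rees_gen_eq_mon_poly)
  then show ?thesis
    by (simp add: mon_subst_def rees_mon_def mon_poly_sum)
qed

lemma lookup_rees_mon:
  assumes "finite A" "Poly_Mapping.keys m \<subseteq> A"
  shows "Poly_Mapping.lookup (rees_mon P m) w =
    (\<Sum>v\<in>A. Poly_Mapping.lookup m v * Poly_Mapping.lookup (gen_mon P v) w)"
proof -
  have "Poly_Mapping.lookup (rees_mon P m) w =
      (\<Sum>v\<in>Poly_Mapping.keys m. Poly_Mapping.lookup m v * Poly_Mapping.lookup (gen_mon P v) w)"
    by (simp add: rees_mon_def lookup_sum)
  also have "\<dots> = (\<Sum>v\<in>A. Poly_Mapping.lookup m v * Poly_Mapping.lookup (gen_mon P v) w)"
    by (rule sum.mono_neutral_left) (use assms in \<open>auto simp: in_keys_iff\<close>)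
  finally show ?thesis .
qed

lemma rees_mon_add: "rees_mon P (m + n) = rees_mon P m + rees_mon P n"
proof (rule poly_mapping_eqI)
  fix w
  let ?A = "Poly_Mapping.keys m \<union> Poly_Mapping.keys n"
  show "Poly_Mapping.lookup (rees_mon P (m + n)) w = Poly_Mapping.lookup (rees_mon P m + rees_mon P n) w"
    by (simp add: lookup_add keys_plus_nat lookup_rees_mon[where A = ?A] distrib_right sum.distrib)
qed

lemma rees_mon_single: "rees_mon P (Poly_Mapping.single v 1) = gen_mon P v"
  by (simp add: rees_mon_def)

lemma T_notin_xyz_vars: "T \<notin> xyz_vars P r"
  by (auto simp: xyz_vars_def)

lemma rees_map_mon_poly:
  assumes "Poly_Mapping.keys m \<subseteq> xyz_vars P r"
  shows "rees_map P (mon_poly m) = (mon_poly (rees_mon P m) :: ('a vars, 'k::comm_ring_1) mpoly)"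
proof -
  have "T \<notin> Poly_Mapping.keys m" using assms T_notin_xyz_vars by blast
  then show ?thesis
    using mon_subst_rees_gen[of m P] by (simp add: rees_map_def mon_poly_def subst_single const_def)
qed

section \<open>Coefficients along the fibres of the monomial map\<close>

lemma lookup_rees_map:
  assumes "f \<in> polys (xyz_vars P r)"
  shows "Poly_Mapping.lookup (rees_map P f) n =
    (\<Sum>m\<in>Poly_Mapping.keys f. if rees_mon P m = n then Poly_Mapping.lookup f m else 0 :: 'k::comm_ring_1)"
proof -
  have "const (Poly_Mapping.lookup f m) * mon_subst (rees_gen P) m =
      Poly_Mapping.single (rees_mon P m) (Poly_Mapping.lookup f m)"
    if "m \<in> Poly_Mapping.keys f" for m
  proof -
    have "T \<notin> Poly_Mapping.keys m" using assms that T_notin_xyz_vars by (auto simp: polys_def)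
    then show ?thesis by (simp add: mon_subst_rees_gen const_def mon_poly_def mult_single)
  qed
  then show ?thesis
    by (simp add: rees_map_def subst_def lookup_sum lookup_single when_def)
qed

text \<open>For an element of the kernel the coefficients over each fibre of \<open>rees_mon\<close>
  add up to zero, so a nonzero one cannot be alone in its fibre.\<close>

lemma rees_ideal_fibre:
  assumes "f \<in> rees_ideal P r" "m \<in> Poly_Mapping.keys f"
  obtains m' where "m' \<in> Poly_Mapping.keys f" "m' \<noteq> m" "rees_mon P m' = rees_mon P m"
proof (rule ccontr)
  assume "\<not> thesis"
  then have "m' = m" if "m' \<in> Poly_Mapping.keys f" "rees_mon P m' = rees_mon P m" for m'
    using that \<open>\<And>m'. m' \<in> Poly_Mapping.keys f \<Longrightarrow> m' \<noteq> m \<Longrightarrow> rees_mon P m' = rees_mon P m \<Longrightarrow> thesis\<close>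
    by blast
  then have "(\<Sum>m'\<in>Poly_Mapping.keys f. if rees_mon P m' = rees_mon P m then Poly_Mapping.lookup f m' else 0)
      = (\<Sum>m'\<in>Poly_Mapping.keys f. if m' = m then Poly_Mapping.lookup f m' else 0)"
    by (intro sum.cong) auto
  also have "\<dots> = Poly_Mapping.lookup f m" using assms(2) by (simp add: sum.delta')
  also have "(\<Sum>m'\<in>Poly_Mapping.keys f. if rees_mon P m' = rees_mon P m then Poly_Mapping.lookup f m' else 0) = 0"
    using lookup_rees_map[of f P r "rees_mon P m"] assms(1) by (simp add: rees_ideal_def)
  finally show False using assms(2) by (simp add: in_keys_iff)
qed

lemma rees_ideal_diff:
  assumes "f \<in> rees_ideal P r" "g \<in> rees_ideal P r"
  shows "f - g \<in> rees_ideal P r"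
proof -
  have "f - g \<in> polys (xyz_vars P r)"
    using assms Poly_Mapping.keys_diff[of f g] unfolding rees_ideal_def polys_def by blast
  moreover have "rees_map P f = rees_map P (f - g) + rees_map P g"
    unfolding rees_map_def by (simp flip: subst_add)
  ultimately show ?thesis using assms by (simp add: rees_ideal_def)
qed

lemma binomial_in_rees_ideal:
  assumes "Poly_Mapping.keys u \<subseteq> xyz_vars P r" "Poly_Mapping.keys v \<subseteq> xyz_vars P r"
    and "rees_mon P u = rees_mon P v"
  shows "(mon_poly u - mon_poly v :: ('a vars, 'k::comm_ring_1) mpoly) \<in> rees_ideal P r"
proof -
  let ?f = "mon_poly u - mon_poly v :: ('a vars, 'k) mpoly"
  have "Poly_Mapping.keys ?f \<subseteq> {u, v}"
    by (auto simp: in_keys_iff lookup_minus lookup_mon_poly split: if_splits)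
  then have "?f \<in> polys (xyz_vars P r)" using assms by (auto simp: polys_def)
  moreover have "rees_map P (mon_poly u) = rees_map P ?f + rees_map P (mon_poly v)"
    unfolding rees_map_def by (simp flip: subst_add)
  ultimately show ?thesis using assms by (simp add: rees_ideal_def rees_map_mon_poly)
qed

section \<open>Exponents in the image of a monomial\<close>

lemma finite_poset_ideals: "finite P \<Longrightarrow> finite (poset_ideals P r)"
  by (rule finite_subset[of _ "Pow P"]) (auto simp: poset_ideals_def poset_ideal_def)

lemma finite_xyz_vars: "finite P \<Longrightarrow> finite (xyz_vars P r)"
  by (simp add: xyz_vars_def finite_poset_ideals)

lemma sum_xyz_vars:
  assumes "finite P"
  shows "sum h (xyz_vars P r) =
    (\<Sum>p\<in>P. h (X p)) + (\<Sum>p\<in>P. h (Y p)) + (\<Sum>I\<in>poset_ideals P r. h (Z I))"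
proof -
  have "sum h (xyz_vars P r) = sum h (X ` P) + sum h (Y ` P) + sum h (Z ` poset_ideals P r)"
    unfolding xyz_vars_def using assms finite_poset_ideals[OF assms]
    by (subst sum.union_disjoint; force?)+
  then show ?thesis by (simp add: sum.reindex inj_on_def)
qed

lemma lookup_gen_mon_Z:
  assumes "finite P" "I \<subseteq> P"
  shows "Poly_Mapping.lookup (gen_mon P (Z I)) (X p) = (if p \<in> I then 1 else 0)"
    and "Poly_Mapping.lookup (gen_mon P (Z I)) (Y p) = (if p \<in> P - I then 1 else 0)"
    and "Poly_Mapping.lookup (gen_mon P (Z I)) T = 1"
  using assms finite_subset[OF assms(2,1)]
  by (simp_all add: lookup_add lookup_sum lookup_single when_def sum.delta)

lemma poset_ideals_subset: "I \<in> poset_ideals P r \<Longrightarrow> I \<subseteq> P"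
  by (simp add: poset_ideals_def poset_ideal_def)

text \<open>These are the quantities shared by all monomials of a fibre: besides \<open>x\<close>
  and \<open>y\<close> exponents, the image records how many \<open>z\<close> factors contain or
  omit \<open>p\<close>, and how many there are in all.\<close>

lemma
  assumes "finite P" "Poly_Mapping.keys m \<subseteq> xyz_vars P r"
  shows lookup_rees_mon_X: "p \<in> P \<Longrightarrow> Poly_Mapping.lookup (rees_mon P m) (X p) =
      Poly_Mapping.lookup m (X p) + (\<Sum>I\<in>{I \<in> poset_ideals P r. p \<in> I}. Poly_Mapping.lookup m (Z I))"
    and lookup_rees_mon_Y: "p \<in> P \<Longrightarrow> Poly_Mapping.lookup (rees_mon P m) (Y p) =
      Poly_Mapping.lookup m (Y p) + (\<Sum>I\<in>{I \<in> poset_ideals P r. p \<notin> I}. Poly_Mapping.lookup m (Z I))"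
    and lookup_rees_mon_T: "Poly_Mapping.lookup (rees_mon P m) T =
      (\<Sum>I\<in>poset_ideals P r. Poly_Mapping.lookup m (Z I))"
proof -
  have gen: "Poly_Mapping.lookup (gen_mon P (Z I)) (X p) = (if p \<in> I then 1 else 0)"
    "Poly_Mapping.lookup (gen_mon P (Z I)) (Y p) = (if p \<in> P - I then 1 else 0)"
    "Poly_Mapping.lookup (gen_mon P (Z I)) T = 1" if "I \<in> poset_ideals P r" for I p
    using lookup_gen_mon_Z[OF assms(1) poset_ideals_subset[OF that]] by blast+
  note sums = lookup_rees_mon[OF finite_xyz_vars[OF assms(1)] assms(2)] sum_xyz_vars[OF assms(1)]
  have fin: "finite (poset_ideals P r)" using assms(1) by (rule finite_poset_ideals)
  show "Poly_Mapping.lookup (rees_mon P m) (X p) =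
      Poly_Mapping.lookup m (X p) + (\<Sum>I\<in>{I \<in> poset_ideals P r. p \<in> I}. Poly_Mapping.lookup m (Z I))"
    if "p \<in> P"
    using that assms(1) fin
    by (auto simp: sums gen lookup_single when_def sum.delta sum.inter_filter if_distrib
        simp del: gen_mon.simps(3) intro!: sum.cong cong: if_cong)
  show "Poly_Mapping.lookup (rees_mon P m) (Y p) =
      Poly_Mapping.lookup m (Y p) + (\<Sum>I\<in>{I \<in> poset_ideals P r. p \<notin> I}. Poly_Mapping.lookup m (Z I))"
    if "p \<in> P"
    using that assms(1) fin
    by (auto simp: sums gen lookup_single when_def sum.delta sum.inter_filter if_distrib
        simp del: gen_mon.simps(3) intro!: sum.cong cong: if_cong)
  show "Poly_Mapping.lookup (rees_mon P m) T = (\<Sum>I\<in>poset_ideals P r. Poly_Mapping.lookup m (Z I))"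
    using fin
    by (auto simp: sums gen lookup_single when_def simp del: gen_mon.simps(3) intro!: sum.cong)
qed

section \<open>Multisets of sets forming a chain\<close>

text \<open>List the sets with positive \<open>e\<close> in decreasing order, each \<open>I\<close>
  repeated \<open>e I\<close> times. A point \<open>p\<close> lies in exactly the first
  \<open>c p\<close> of these \<open>k\<close> sets, so the \<open>j\<close>-th one is
  \<open>L j\<close>, and \<open>c\<close> together with \<open>k\<close> determines
  \<open>e\<close>.\<close>

lemma chain_multiplicity:
  fixes e :: "'a set \<Rightarrow> nat"
  assumes D: "finite D" "\<And>I. I \<in> D \<Longrightarrow> I \<subseteq> P"
    and chain: "\<And>I J. I \<in> D \<Longrightarrow> J \<in> D \<Longrightarrow> 0 < e I \<Longrightarrow> 0 < e J \<Longrightarrow> I \<subseteq> J \<or> J \<subseteq> I"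
  defines "c \<equiv> \<lambda>p. \<Sum>I\<in>{I \<in> D. p \<in> I}. e I" and "k \<equiv> \<Sum>I\<in>D. e I"
  defines "L \<equiv> \<lambda>j. {p \<in> P. j \<le> c p}"
  shows "I \<in> D \<Longrightarrow> e I = card {j \<in> {1..k}. L j = I}"
    and "j \<in> {1..k} \<Longrightarrow> L j \<in> D"
proof -
  let ?C = "\<lambda>I. {j \<in> {1..k}. L j = I}"
  have le: "e I \<le> card (?C I)" if I: "I \<in> D" for I
  proof (cases "e I = 0")
    case False
    let ?A = "{J \<in> D. I \<subset> J}"
    define U where "U = sum e ?A"
    have U: "U + e I = sum e (insert I ?A)" using D by (simp add: U_def)
    have k: "U + e I \<le> k"
      unfolding U k_def by (rule sum_mono2) (use D I in auto)
    have inside: "U + e I \<le> c p" if "p \<in> I" for p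
      unfolding U c_def by (rule sum_mono2) (use D I that in auto)
    \<comment> \<open>A chain member containing a point outside \<open>I\<close> is comparable with
      \<open>I\<close> but not inside it, so it contains \<open>I\<close> properly.\<close>
    have outside: "c p \<le> U" if "p \<notin> I" for p
    proof -
      have "c p = sum e {J \<in> D. p \<in> J \<and> 0 < e J}"
        unfolding c_def by (rule sum.mono_neutral_right) (use D in auto)
      also have "\<dots> \<le> U"
        unfolding U_def by (rule sum_mono2) (use D I False chain[of I] that in auto)
      finally show ?thesis .
    qed
    \<comment> \<open>The \<open>j\<close>-th largest member of the chain is \<open>L j\<close>, and \<open>I\<close> takes the places \<open>U + 1, \<dots>, U + e I\<close>.\<close>
    have "{U + 1..U + e I} \<subseteq> ?C I"
    proof
      fix j assume j: "j \<in> {U + 1..U + e I}"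
      have "L j = I"
        using j inside outside D(2)[OF I] unfolding L_def by fastforce
      then show "j \<in> ?C I" using j k by auto
    qed
    then have "card {U + 1..U + e I} \<le> card (?C I)" by (intro card_mono) auto
    then show ?thesis by simp
  qed simp
  have card: "(\<Sum>I\<in>D. card (?C I)) = card {j \<in> {1..k}. L j \<in> D}"
  proof -
    have "(\<Sum>I\<in>D. card (?C I)) = card (\<Union>I\<in>D. ?C I)"
      by (rule card_UN_disjoint[symmetric]) (use D in auto)
    also have "(\<Union>I\<in>D. ?C I) = {j \<in> {1..k}. L j \<in> D}" by auto
    finally show ?thesis .
  qed
  have k: "sum e D = k" by (simp add: k_def)
  \<comment> \<open>The multiplicities sum to \<open>k\<close>, while the disjoint index sets
    \<open>?C I\<close> have at most \<open>k\<close> elements in all. So every inequality in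
    \<open>le\<close> is an equality, and every \<open>L j\<close> belongs to
    \<open>D\<close>.\<close>
  have "sum e D \<le> (\<Sum>I\<in>D. card (?C I))" using le by (rule sum_mono)
  then have "k \<le> card {j \<in> {1..k}. L j \<in> D}" unfolding card k .
  moreover have "card {j \<in> {1..k}. L j \<in> D} \<le> card {1..k}" by (intro card_mono) auto
  ultimately have eq: "card {j \<in> {1..k}. L j \<in> D} = k" by simp
  have "sum e D = (\<Sum>I\<in>D. card (?C I))" unfolding card k eq ..
  then show "e I = card (?C I)" if "I \<in> D"
    using le that D(1) by (rule sum_mono_inv)
  have "{j \<in> {1..k}. L j \<in> D} = {1..k}" using eq by (intro card_subset_eq) auto
  then show "L j \<in> D" if "j \<in> {1..k}" using that by blast
qed

section \<open>The quadratic relations\<close>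

text \<open>Pairs of monomials rather than polynomials: the intended initial term is the first
  component, and coefficients and order stay out of the combinatorics. In the second family,
  exchanging \<open>I\<close> and \<open>J\<close> gives the same pair.\<close>

definition rees_relations :: "'a set \<Rightarrow> ('a \<times> 'a) set \<Rightarrow> ('a vars monom \<times> 'a vars monom) set"
  where "rees_relations P r =
    {(Poly_Mapping.single (X p) 1 + Poly_Mapping.single (Z I) 1,
      Poly_Mapping.single (Y p) 1 + Poly_Mapping.single (Z (insert p I)) 1) | p I.
      p \<in> P \<and> p \<notin> I \<and> I \<in> poset_ideals P r \<and> insert p I \<in> poset_ideals P r} \<union>
    {(Poly_Mapping.single (Z I) 1 + Poly_Mapping.single (Z J) 1,
      Poly_Mapping.single (Z (I \<union> J)) 1 + Poly_Mapping.single (Z (I \<inter> J)) 1) | I J.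
      I \<in> poset_ideals P r \<and> J \<in> poset_ideals P r \<and> \<not> I \<subseteq> J \<and> \<not> J \<subseteq> I}"

lemma rees_relations_cases [consumes 1, case_names XZ ZZ]:
  assumes "(u, v) \<in> rees_relations P r"
  obtains p I where "u = Poly_Mapping.single (X p) 1 + Poly_Mapping.single (Z I) 1"
      "v = Poly_Mapping.single (Y p) 1 + Poly_Mapping.single (Z (insert p I)) 1"
      "p \<in> P" "p \<notin> I" "I \<in> poset_ideals P r" "insert p I \<in> poset_ideals P r"
    | I J where "u = Poly_Mapping.single (Z I) 1 + Poly_Mapping.single (Z J) 1"
      "v = Poly_Mapping.single (Z (I \<union> J)) 1 + Poly_Mapping.single (Z (I \<inter> J)) 1"
      "I \<in> poset_ideals P r" "J \<in> poset_ideals P r" "\<not> I \<subseteq> J" "\<not> J \<subseteq> I"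
  using assms unfolding rees_relations_def by blast

lemma poset_ideals_Un: "I \<in> poset_ideals P r \<Longrightarrow> J \<in> poset_ideals P r \<Longrightarrow> I \<union> J \<in> poset_ideals P r"
  and poset_ideals_Int: "I \<in> poset_ideals P r \<Longrightarrow> J \<in> poset_ideals P r \<Longrightarrow> I \<inter> J \<in> poset_ideals P r"
  unfolding poset_ideals_def poset_ideal_def by blast+

lemma mon_deg_alt:
  assumes "finite A" "Poly_Mapping.keys m \<subseteq> A"
  shows "mon_deg m = (\<Sum>v\<in>A. Poly_Mapping.lookup m v)"
  unfolding mon_deg_def
  by (rule sum.mono_neutral_left) (use assms in \<open>auto simp: in_keys_iff\<close>)

lemma mon_deg_add: "mon_deg (m + n) = mon_deg m + mon_deg n"
  by (simp add: mon_deg_alt[where A = "Poly_Mapping.keys m \<union> Poly_Mapping.keys n"]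
      keys_plus_nat lookup_add sum.distrib)

lemma mon_deg_single [simp]: "mon_deg (Poly_Mapping.single v c) = c"
  by (simp add: mon_deg_def)

lemma lookup_le_mon_deg: "Poly_Mapping.lookup m v \<le> mon_deg m"
  by (cases "v \<in> Poly_Mapping.keys m") (auto simp: mon_deg_def in_keys_iff intro: member_le_sum)

text \<open>The cofactor has degree 0. As all terms of the relations have degree 2, divisibility
  between them becomes equality.\<close>

lemma mon_dvd_eq_deg:
  assumes "mon_dvd m n" "mon_deg m = mon_deg n"
  shows "m = n"
proof -
  obtain k where k: "n = m + k" using assms(1) by (auto simp: mon_dvd_def)
  then have "mon_deg k = 0" using assms(2) by (simp add: mon_deg_add)
  then have "k = 0"
    using lookup_le_mon_deg[of k] by (intro poly_mapping_eqI) auto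
  then show ?thesis by (simp add: k)
qed

lemma single_add_single_eq:
  assumes "Poly_Mapping.single a 1 + Poly_Mapping.single b 1 =
    (Poly_Mapping.single c 1 + Poly_Mapping.single d 1 :: 'v monom)"
  shows "a = c \<and> b = d \<or> a = d \<and> b = c"
proof -
  have "{a, b} = {c, d}" using arg_cong[OF assms, of Poly_Mapping.keys] by (simp add: keys_plus_nat insert_commute)
  then show ?thesis by (auto simp: doubleton_eq_iff)
qed

lemma rees_relations_keys:
  assumes "(u, v) \<in> rees_relations P r"
  shows "Poly_Mapping.keys u \<subseteq> xyz_vars P r" "Poly_Mapping.keys v \<subseteq> xyz_vars P r"
  using assms
  by (cases rule: rees_relations_cases;
      simp add: keys_plus_nat xyz_vars_def poset_ideals_Un poset_ideals_Int)+

lemma rees_relations_deg: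
  assumes "(u, v) \<in> rees_relations P r"
  shows "mon_deg u = 2" "mon_deg v = 2"
  using assms by (cases rule: rees_relations_cases; simp add: mon_deg_add)+

lemma rees_relations_squarefree: "(u, v) \<in> rees_relations P r \<Longrightarrow> squarefree_mon u"
  by (cases rule: rees_relations_cases)
    (auto simp: squarefree_mon_def lookup_add lookup_single when_def)

text \<open>Adding \<open>p\<close> to \<open>I\<close> replaces the \<open>y\<close> factor at
  \<open>p\<close> in the image by the \<open>x\<close> factor, which the accompanying variables
  compensate. For two ideals, a point lies in as many of \<open>I\<close>, \<open>J\<close> as of
  their union and intersection.\<close>

lemma rees_relations_rees_mon:
  assumes "finite P" "(u, v) \<in> rees_relations P r"
  shows "rees_mon P u = rees_mon P v"
  using assms(2)
proof (cases rule: rees_relations_cases)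
  case (XZ p I)
  have fin: "finite I" using poset_ideals_subset[OF XZ(5)] assms(1) by (rule finite_subset)
  have "(\<Sum>q\<in>P - I. Poly_Mapping.single (Y q) (1::nat)) =
      Poly_Mapping.single (Y p) 1 + (\<Sum>q\<in>P - insert p I. Poly_Mapping.single (Y q) 1)"
    using sum.remove[of "P - I" p] XZ assms(1) by (simp add: Diff_insert[symmetric])
  then have "gen_mon P (X p) + gen_mon P (Z I) = gen_mon P (Y p) + gen_mon P (Z (insert p I))"
    using XZ fin by (simp add: add_ac)
  then show ?thesis by (simp only: XZ rees_mon_add rees_mon_single)
next
  case (ZZ I J)
  have fin: "finite I" "finite J" "finite (P - I)" "finite (P - J)"
    using finite_subset[OF poset_ideals_subset[OF ZZ(3)] assms(1)]
      finite_subset[OF poset_ideals_subset[OF ZZ(4)] assms(1)] assms(1) by simp_all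
  have "gen_mon P (Z I) + gen_mon P (Z J) = gen_mon P (Z (I \<union> J)) + gen_mon P (Z (I \<inter> J))"
  proof (rule poly_mapping_eqI)
    fix w
    \<comment> \<open>The \<open>x\<close> part compares \<open>I\<close> and \<open>J\<close>, the
      \<open>y\<close> part their complements, where De Morgan swaps union and intersection.\<close>
    show "Poly_Mapping.lookup (gen_mon P (Z I) + gen_mon P (Z J)) w =
        Poly_Mapping.lookup (gen_mon P (Z (I \<union> J)) + gen_mon P (Z (I \<inter> J))) w"
      using arg_cong[OF sum.union_inter[OF fin(1,2), of "\<lambda>p. Poly_Mapping.single (X p) (1::nat)"],
          of "\<lambda>m. Poly_Mapping.lookup m w"]
        arg_cong[OF sum.union_inter[OF fin(3,4), of "\<lambda>p. Poly_Mapping.single (Y p) (1::nat)"],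
          of "\<lambda>m. Poly_Mapping.lookup m w"]
      by (simp add: lookup_add Diff_Un Diff_Int)
  qed
  then show ?thesis by (simp only: ZZ rees_mon_add rees_mon_single)
qed

text \<open>By degree the terms would be equal, but a first term has an \<open>x\<close> variable or
  two incomparable ideals, a second term a \<open>y\<close> variable or two comparable
  ideals.\<close>

lemma rees_relations_not_dvd:
  assumes "(u, v) \<in> rees_relations P r" "(u', v') \<in> rees_relations P r"
  shows "\<not> mon_dvd u v'"
proof
  assume "mon_dvd u v'"
  then have "u = v'" using assms rees_relations_deg by (metis mon_dvd_eq_deg)
  with assms show False
    by (elim rees_relations_cases) (auto dest!: single_add_single_eq simp del: One_nat_def)
qed

text \<open>By degree the first terms agree, and they determine \<open>p\<close> and
  \<open>I\<close>, or \<open>I\<close> and \<open>J\<close> up to order; union and intersection are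
  symmetric.\<close>

lemma rees_relations_unique:
  assumes "(u, v) \<in> rees_relations P r" "(u', v') \<in> rees_relations P r" "mon_dvd u u'"
  shows "u = u' \<and> v = v'"
proof -
  have "u = u'" using assms rees_relations_deg by (metis mon_dvd_eq_deg)
  moreover from this have "v = v'"
    using assms(1,2)
    by (elim rees_relations_cases) (auto dest!: single_add_single_eq simp: Un_commute Int_commute simp del: One_nat_def)
  ultimately show ?thesis by blast
qed

section \<open>Finiteness and initial terms of the relations\<close>

lemma finite_bounded_monomials:
  assumes "finite V"
  shows "finite {m :: 'v monom. Poly_Mapping.keys m \<subseteq> V \<and> (\<forall>v. Poly_Mapping.lookup m v \<le> N)}"
proof (rule finite_imageD[of Poly_Mapping.lookup])
  show "finite (Poly_Mapping.lookup ` {m :: 'v monom. Poly_Mapping.keys m \<subseteq> V \<and> (\<forall>v. Poly_Mapping.lookup m v \<le> N)})"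
    by (rule finite_subset[OF _ finite_set_of_finite_funs[OF assms finite_atMost[of N], of 0]])
      (auto simp: in_keys_iff)
qed (auto intro!: inj_onI poly_mapping_eqI)

lemma finite_rees_relations:
  assumes "finite P"
  shows "finite (rees_relations P r)"
proof -
  let ?M = "{m :: 'a vars monom. Poly_Mapping.keys m \<subseteq> xyz_vars P r \<and> (\<forall>v. Poly_Mapping.lookup m v \<le> (2::nat))}"
  have "rees_relations P r \<subseteq> ?M \<times> ?M"
  proof (rule subrelI)
    fix u v assume uv: "(u, v) \<in> rees_relations P r"
    show "(u, v) \<in> ?M \<times> ?M"
      using rees_relations_keys[OF uv] rees_relations_deg[OF uv]
        lookup_le_mon_deg[of u] lookup_le_mon_deg[of v] by simp
  qed
  moreover have "finite ?M" by (intro finite_bounded_monomials finite_xyz_vars assms)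
  ultimately show ?thesis by (meson finite_SigmaI finite_subset)
qed

text \<open>In the first family only \<open>u\<close> contains an \<open>x\<close> variable. In the
  second, the \<open>z\<close> degrees agree, and the smallest of the four variables, that of
  \<open>I \<inter> J\<close>, occurs only in \<open>v\<close>, which makes \<open>v\<close> smaller
  in the reverse order.\<close>

lemma rees_relations_less:
  assumes ps: "distinct ps" "set ps = P" and Is: "admissible_enum P r Is"
    and uv: "(u, v) \<in> rees_relations P r"
  shows "lex_sharp_less ps Is v u"
  using uv
proof (cases rule: rees_relations_cases)
  case (XZ p I)
  obtain k where k: "k < length ps" "ps ! k = p" using XZ ps by (metis in_set_conv_nth)
  have "lex_less (map X ps @ map Y ps) v u"
    unfolding lex_less_def
  proof (intro exI[of _ k] conjI allI impI)
    fix j assume j: "j < k"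
    then have "ps ! j \<noteq> p" using nth_eq_iff_index_eq[OF ps(1), of j k] k by auto
    then show "Poly_Mapping.lookup v ((map X ps @ map Y ps) ! j) = Poly_Mapping.lookup u ((map X ps @ map Y ps) ! j)"
      using j k(1) by (simp add: XZ nth_append lookup_add lookup_single when_def)
  qed (use k in \<open>simp_all add: XZ nth_append lookup_add lookup_single when_def\<close>)
  then show ?thesis by (simp add: lex_sharp_less_def)
next
  case (ZZ I J)
  have D: "I \<union> J \<in> poset_ideals P r" "I \<inter> J \<in> poset_ideals P r"
    using ZZ poset_ideals_Un poset_ideals_Int by blast+
  have Is': "distinct Is" "set Is = poset_ideals P r"
    "\<And>i j. i < length Is \<Longrightarrow> j < length Is \<Longrightarrow> Is ! j \<subset> Is ! i \<Longrightarrow> i < j"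
    using Is by (auto simp: admissible_enum_def)
  obtain k where k: "k < length Is" "Is ! k = I \<inter> J" using D(2) Is'(2) by (metis in_set_conv_nth)
  \<comment> \<open>Ideals properly containing \<open>I \<inter> J\<close> are listed before it, so
    its position is the last at which the terms can differ.\<close>
  have after: "Is ! j \<notin> {I, J, I \<union> J, I \<inter> J}" if "k < j" "j < length Is" for j
  proof -
    have "\<not> I \<inter> J \<subset> Is ! j" using Is'(3)[of j k] that k by auto
    moreover have "Is ! j \<noteq> I \<inter> J" using nth_eq_iff_index_eq[OF Is'(1), of j k] that k by auto
    ultimately show ?thesis using ZZ(5,6) by blast
  qed
  have fin: "finite (poset_ideals P r)" unfolding Is'(2)[symmetric] by (rule finite_set)
  have deg: "(\<Sum>v\<in>Z ` set Is. Poly_Mapping.lookup (Poly_Mapping.single (Z A) 1) v) = (1::nat)"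
    if "A \<in> poset_ideals P r" for A
    using that fin unfolding Is'(2)
    by (subst sum.reindex) (auto simp: inj_on_def lookup_single when_def sum.delta)
  have "degrevlex_less (map Z Is) v u"
    unfolding degrevlex_less_def Let_def
  proof (intro disjI2 conjI exI[of _ k] allI impI)
    show "(\<Sum>w\<in>set (map Z Is). Poly_Mapping.lookup v w) = (\<Sum>w\<in>set (map Z Is). Poly_Mapping.lookup u w)"
      using deg ZZ(3,4) D by (simp add: ZZ(1,2) lookup_add sum.distrib)
    show "Poly_Mapping.lookup u (map Z Is ! k) < Poly_Mapping.lookup v (map Z Is ! k)"
      using k ZZ(5,6) by (auto simp: ZZ(1,2) lookup_add lookup_single when_def)
    fix j assume j: "k < j \<and> j < length (map Z Is)"
    then have "Is ! j \<notin> {I, J, I \<union> J, I \<inter> J}" using after by simp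
    with j show "Poly_Mapping.lookup v (map Z Is ! j) = Poly_Mapping.lookup u (map Z Is ! j)"
      by (simp add: ZZ(1,2) lookup_add lookup_single when_def eq_commute[of _ "Is ! j"])
  qed (use k in simp)
  moreover have "\<forall>w\<in>set (map X ps @ map Y ps). Poly_Mapping.lookup v w = Poly_Mapping.lookup u w"
    by (auto simp: ZZ(1,2) lookup_add lookup_single when_def)
  ultimately show ?thesis by (simp add: lex_sharp_less_def Let_def)
qed

section \<open>Standard monomials\<close>

definition standard_mon :: "'a set \<Rightarrow> ('a \<times> 'a) set \<Rightarrow> 'a vars monom \<Rightarrow> bool"
  where "standard_mon P r m \<longleftrightarrow> Poly_Mapping.keys m \<subseteq> xyz_vars P r \<and>
    (\<forall>(u, v)\<in>rees_relations P r. \<not> mon_dvd u m)"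

lemma single_add_single_dvd:
  assumes "0 < Poly_Mapping.lookup m a" "0 < Poly_Mapping.lookup m b" "a \<noteq> b"
  shows "mon_dvd (Poly_Mapping.single a 1 + Poly_Mapping.single b 1) m"
  using assms by (auto simp: mon_dvd_iff lookup_add lookup_single when_def)

lemma standard_mon_chain:
  assumes "standard_mon P r m" "I \<in> poset_ideals P r" "J \<in> poset_ideals P r"
    and "0 < Poly_Mapping.lookup m (Z I)" "0 < Poly_Mapping.lookup m (Z J)"
  shows "I \<subseteq> J \<or> J \<subseteq> I"
proof (rule ccontr)
  assume *: "\<not> ?thesis"
  then have "(Poly_Mapping.single (Z I) 1 + Poly_Mapping.single (Z J) 1,
      Poly_Mapping.single (Z (I \<union> J)) 1 + Poly_Mapping.single (Z (I \<inter> J)) 1) \<in> rees_relations P r"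
    using assms(2,3) unfolding rees_relations_def by blast
  moreover have "mon_dvd (Poly_Mapping.single (Z I) 1 + Poly_Mapping.single (Z J) 1) m"
    using assms(4,5) * by (intro single_add_single_dvd) auto
  ultimately show False using assms(1) by (auto simp: standard_mon_def)
qed

lemma standard_mon_XZ:
  assumes "standard_mon P r m" "p \<in> P" "p \<notin> I" "I \<in> poset_ideals P r" "insert p I \<in> poset_ideals P r"
    and "0 < Poly_Mapping.lookup m (X p)" "0 < Poly_Mapping.lookup m (Z I)"
  shows False
proof -
  have "(Poly_Mapping.single (X p) 1 + Poly_Mapping.single (Z I) 1,
      Poly_Mapping.single (Y p) 1 + Poly_Mapping.single (Z (insert p I)) 1) \<in> rees_relations P r"
    using assms(2-5) unfolding rees_relations_def by blast
  moreover have "mon_dvd (Poly_Mapping.single (X p) 1 + Poly_Mapping.single (Z I) 1) m"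
    using assms(6,7) by (intro single_add_single_dvd) auto
  ultimately show False using assms(1) by (auto simp: standard_mon_def)
qed

text \<open>This is \<open>c p\<close> of \<open>chain_multiplicity\<close> with \<open>e I\<close>
  the exponent of \<open>Z I\<close>.\<close>

definition z_count :: "'a set \<Rightarrow> ('a \<times> 'a) set \<Rightarrow> 'a vars monom \<Rightarrow> 'a \<Rightarrow> nat"
  where "z_count P r m p = (\<Sum>I\<in>{I \<in> poset_ideals P r. p \<in> I}. Poly_Mapping.lookup m (Z I))"

lemma z_count_antimono:
  assumes "finite P" "p \<in> P" "q \<in> P" "(q, p) \<in> r"
  shows "z_count P r m p \<le> z_count P r m q"
  unfolding z_count_def
  by (rule sum_mono2)
    (use assms in \<open>auto simp: finite_poset_ideals poset_ideals_def poset_ideal_def\<close>)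

lemma standard_mon_multiplicity:
  fixes m :: "'a vars monom"
  assumes "finite P" "standard_mon P r m"
  defines "k \<equiv> \<Sum>I\<in>poset_ideals P r. Poly_Mapping.lookup m (Z I)"
  shows "I \<in> poset_ideals P r \<Longrightarrow>
      Poly_Mapping.lookup m (Z I) = card {j \<in> {1..k}. {p \<in> P. j \<le> z_count P r m p} = I}"
    and "j \<in> {1..k} \<Longrightarrow> {p \<in> P. j \<le> z_count P r m p} \<in> poset_ideals P r"
  using chain_multiplicity[of "poset_ideals P r" P "\<lambda>I. Poly_Mapping.lookup m (Z I)"]
    finite_poset_ideals[OF assms(1)] poset_ideals_subset standard_mon_chain[OF assms(2)]
  unfolding k_def z_count_def by blast+

text \<open>If \<open>m\<close> counts more at \<open>p\<close>, the chain member of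
  \<open>m'\<close> at place \<open>z_count P r m p\<close> misses \<open>p\<close> but contains
  everything strictly below \<open>p\<close>, so \<open>p\<close> can be added to it; and
  \<open>m'\<close> is divisible by the \<open>x\<close> variable of \<open>p\<close>. A standard
  monomial cannot have both.\<close>

lemma standard_mon_z_count_le:
  assumes "finite P" "standard_mon P r m'" "Poly_Mapping.keys m \<subseteq> xyz_vars P r"
    and eq: "rees_mon P m = rees_mon P m'"
    and p: "p \<in> P" "\<And>q. q \<in> P \<Longrightarrow> (q, p) \<in> r \<Longrightarrow> q \<noteq> p \<Longrightarrow> z_count P r m q = z_count P r m' q"
  shows "z_count P r m p \<le> z_count P r m' p"
proof (rule ccontr)
  define k where "k = (\<Sum>I\<in>poset_ideals P r. Poly_Mapping.lookup m' (Z I))"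
  define j where "j = z_count P r m p"
  define J where "J = {q \<in> P. j \<le> z_count P r m' q}"
  assume "\<not> ?thesis"
  then have less: "z_count P r m' p < j" by (simp add: j_def)
  have keys': "Poly_Mapping.keys m' \<subseteq> xyz_vars P r" using assms(2) by (simp add: standard_mon_def)
  \<comment> \<open>Both monomials have \<open>k\<close> factors \<open>z\<close>, which bounds the
    count \<open>j\<close>; so \<open>j\<close> is a genuine place in the chain of
    \<open>m'\<close>.\<close>
  have "k = (\<Sum>I\<in>poset_ideals P r. Poly_Mapping.lookup m (Z I))"
    unfolding k_def
    using lookup_rees_mon_T[OF assms(1,3)] lookup_rees_mon_T[OF assms(1) keys'] eq by simp
  moreover have "j \<le> (\<Sum>I\<in>poset_ideals P r. Poly_Mapping.lookup m (Z I))"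
    unfolding j_def z_count_def
    by (rule sum_mono2) (auto simp: finite_poset_ideals assms(1))
  ultimately have j: "j \<in> {1..k}" using less by simp
  have J: "J \<in> poset_ideals P r"
    using standard_mon_multiplicity(2)[OF assms(1,2)] j unfolding J_def k_def by blast
  have "Poly_Mapping.lookup m' (Z J) = card {j \<in> {1..k}. {p \<in> P. j \<le> z_count P r m' p} = J}"
    using standard_mon_multiplicity(1)[OF assms(1,2) J] unfolding k_def .
  moreover have "j \<in> {j \<in> {1..k}. {p \<in> P. j \<le> z_count P r m' p} = J}" using j by (simp add: J_def)
  ultimately have "0 < Poly_Mapping.lookup m' (Z J)" by (auto simp: card_gt_0_iff)
  \<comment> \<open>The images agree at \<open>X p\<close>, so the smaller count of
    \<open>m'\<close> is made up by \<open>x\<close> factors.\<close>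
  moreover have "0 < Poly_Mapping.lookup m' (X p)"
    using lookup_rees_mon_X[OF assms(1,3) p(1)] lookup_rees_mon_X[OF assms(1) keys' p(1)] eq less
    unfolding j_def z_count_def by simp
  moreover have "p \<notin> J" using less by (simp add: J_def)
  moreover have "insert p J \<in> poset_ideals P r"
  proof -
    \<comment> \<open>Strictly below \<open>p\<close> the counts of \<open>m\<close> and
      \<open>m'\<close> agree, and that of \<open>m\<close> is at least its count \<open>j\<close>
      at \<open>p\<close>.\<close>
    have "q \<in> insert p J" if "q \<in> P" "(q, p) \<in> r" for q
    proof (cases "q = p")
      case False
      then show ?thesis
        using p(2)[of q] that z_count_antimono[OF assms(1) p(1), of q r m] by (simp add: J_def j_def)
    qed simp
    then show ?thesis using J p(1) unfolding poset_ideals_def poset_ideal_def by blast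
  qed
  ultimately show False using standard_mon_XZ[OF assms(2) p(1)] J by blast
qed

lemma standard_mon_unique:
  assumes P: "finite P" "partial_order_on P r" and std: "standard_mon P r m" "standard_mon P r m'"
    and eq: "rees_mon P m = rees_mon P m'"
  shows "m = m'"
proof -
  have keys: "Poly_Mapping.keys m \<subseteq> xyz_vars P r" "Poly_Mapping.keys m' \<subseteq> xyz_vars P r"
    using std by (simp_all add: standard_mon_def)
  note X = lookup_rees_mon_X[OF P(1) keys(1)] lookup_rees_mon_X[OF P(1) keys(2)]
  note Y = lookup_rees_mon_Y[OF P(1) keys(1)] lookup_rees_mon_Y[OF P(1) keys(2)]
  note T = lookup_rees_mon_T[OF P(1) keys(1)] lookup_rees_mon_T[OF P(1) keys(2)]
  have c: "z_count P r m p = z_count P r m' p" if "p \<in> P" for p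
  proof (rule ccontr)
    assume neq: "z_count P r m p \<noteq> z_count P r m' p"
    \<comment> \<open>At a minimal element of \<open>?B\<close> the exchange argument applies in
      both directions.\<close>
    let ?B = "{p \<in> P. z_count P r m p \<noteq> z_count P r m' p}"
    have r: "antisym r" "trans r" using P(2) by (auto simp: partial_order_on_def preorder_on_def)
    have "transp_on ?B (\<lambda>q p. (q, p) \<in> r \<and> q \<noteq> p)" "asymp_on ?B (\<lambda>q p. (q, p) \<in> r \<and> q \<noteq> p)"
      using r by (auto intro!: transp_onI asymp_onI dest: antisymD transD)
    then have "\<exists>q\<in>?B. \<forall>s\<in>?B. s \<noteq> q \<longrightarrow> \<not> ((s, q) \<in> r \<and> s \<noteq> q)"
      using P(1) neq that by (intro Finite_Set.bex_min_element) auto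
    then obtain q where q: "q \<in> P" "z_count P r m q \<noteq> z_count P r m' q"
      "\<And>s. s \<in> P \<Longrightarrow> (s, q) \<in> r \<Longrightarrow> s \<noteq> q \<Longrightarrow> z_count P r m s = z_count P r m' s"
      by blast
    have "z_count P r m q \<le> z_count P r m' q"
      using standard_mon_z_count_le[OF P(1) std(2) keys(1) eq q(1,3)] .
    moreover have "z_count P r m' q \<le> z_count P r m q"
      using standard_mon_z_count_le[OF P(1) std(1) keys(2) eq[symmetric] q(1)] q(3) by simp
    ultimately show False using q(2) by simp
  qed
  have c': "{p \<in> P. j \<le> z_count P r m p} = {p \<in> P. j \<le> z_count P r m' p}" for j
    using c by auto
  \<comment> \<open>Equal images at \<open>T\<close> give the same \<open>k\<close>, so the two
    chains agree place by place.\<close>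
  have Z: "Poly_Mapping.lookup m (Z I) = Poly_Mapping.lookup m' (Z I)" if "I \<in> poset_ideals P r" for I
    using standard_mon_multiplicity(1)[OF P(1) std(1) that] standard_mon_multiplicity(1)[OF P(1) std(2) that]
      eq T by (simp add: c')
  \<comment> \<open>Subtracting the equal \<open>z\<close> contributions from the common image
    leaves equal \<open>x\<close> and \<open>y\<close> exponents.\<close>
  show ?thesis
  proof (rule poly_mapping_eqI)
    fix v
    show "Poly_Mapping.lookup m v = Poly_Mapping.lookup m' v"
    proof (cases "v \<in> xyz_vars P r")
      case True
      then consider p where "p \<in> P" "v = X p" | p where "p \<in> P" "v = Y p"
        | I where "I \<in> poset_ideals P r" "v = Z I"
        by (auto simp: xyz_vars_def)
      then show ?thesis
      proof cases
        case (1 p)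
        then show ?thesis using X[of p] eq Z by simp
      next
        case (2 p)
        then show ?thesis using Y[of p] eq Z by simp
      next
        case (3 I)
        then show ?thesis using Z by simp
      qed
    next
      case False
      then show ?thesis using keys by (metis in_keys_iff subsetD)
    qed
  qed
qed

text \<open>The exponents of \<open>X p\<close> and \<open>Y p\<close> are bounded by the same
  exponents of the image, that of \<open>Z I\<close> by the exponent of \<open>T\<close>. Finiteness
  provides a smallest element of the fibre.\<close>

lemma finite_rees_mon_fibre:
  assumes "finite P"
  shows "finite {m. Poly_Mapping.keys m \<subseteq> xyz_vars P r \<and> rees_mon P m = n}"
proof (rule finite_subset)
  show "finite {m. Poly_Mapping.keys m \<subseteq> xyz_vars P r \<and> (\<forall>v. Poly_Mapping.lookup m v \<le> mon_deg n)}"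
    by (intro finite_bounded_monomials finite_xyz_vars assms)
  have "Poly_Mapping.lookup m v \<le> mon_deg (rees_mon P m)"
    if m: "Poly_Mapping.keys m \<subseteq> xyz_vars P r" for m v
  proof (cases "v \<in> xyz_vars P r")
    case True
    then consider p where "p \<in> P" "v = X p" | p where "p \<in> P" "v = Y p"
      | I where "I \<in> poset_ideals P r" "v = Z I"
      by (auto simp: xyz_vars_def)
    then have "\<exists>w. Poly_Mapping.lookup m v \<le> Poly_Mapping.lookup (rees_mon P m) w"
    proof cases
      case (1 p)
      then show ?thesis using lookup_rees_mon_X[OF assms m] by (intro exI[of _ "X p"]) simp
    next
      case (2 p)
      then show ?thesis using lookup_rees_mon_Y[OF assms m] by (intro exI[of _ "Y p"]) simp
    next
      case (3 I)
      then show ?thesis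
        using lookup_rees_mon_T[OF assms m] finite_poset_ideals[OF assms, of r]
        by (intro exI[of _ T]) (auto intro: member_le_sum)
    qed
    then obtain w where "Poly_Mapping.lookup m v \<le> Poly_Mapping.lookup (rees_mon P m) w" by blast
    also have "\<dots> \<le> mon_deg (rees_mon P m)" by (rule lookup_le_mon_deg)
    finally show ?thesis .
  next
    case False
    then have "Poly_Mapping.lookup m v = 0" using m by (metis in_keys_iff subsetD)
    then show ?thesis by simp
  qed
  then show "{m. Poly_Mapping.keys m \<subseteq> xyz_vars P r \<and> rees_mon P m = n} \<subseteq>
      {m. Poly_Mapping.keys m \<subseteq> xyz_vars P r \<and> (\<forall>v. Poly_Mapping.lookup m v \<le> mon_deg n)}"
    by auto
qed

text \<open>The smallest monomial of the fibre is standard, since replacing a factor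
  \<open>u\<close> by \<open>v\<close> stays in the fibre and goes down; by uniqueness it is
  \<open>m\<close>.\<close>

lemma standard_mon_minimal:
  assumes P: "finite P" "partial_order_on P r" and lt: "monomial_order (xyz_vars P r) lt"
    and less: "\<And>u v. (u, v) \<in> rees_relations P r \<Longrightarrow> lt v u"
    and std: "standard_mon P r m" and m': "Poly_Mapping.keys m' \<subseteq> xyz_vars P r" "m' \<noteq> m"
    and eq: "rees_mon P m' = rees_mon P m"
  shows "lt m m'"
proof -
  interpret monomial_order "xyz_vars P r" lt by (fact lt)
  let ?F = "{n. Poly_Mapping.keys n \<subseteq> xyz_vars P r \<and> rees_mon P n = rees_mon P m}"
  have m: "m \<in> ?F" using std by (simp add: standard_mon_def)
  have "\<exists>n\<in>?F. \<forall>n'\<in>?F. n' \<noteq> n \<longrightarrow> \<not> lt n' n"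
    using finite_rees_mon_fibre[OF P(1)] m transp_asymp by (intro Finite_Set.bex_min_element) blast+
  then obtain n where n: "n \<in> ?F" "\<And>n'. n' \<in> ?F \<Longrightarrow> n' \<noteq> n \<Longrightarrow> \<not> lt n' n"
    by blast
  have "standard_mon P r n"
    unfolding standard_mon_def
  proof (intro conjI ballI, goal_cases)
    case (2 uv)
    obtain u v where uv: "uv = (u, v)" "(u, v) \<in> rees_relations P r" using 2 by (cases uv) auto
    have "\<not> mon_dvd u n"
    proof
      assume "mon_dvd u n"
      then obtain k where k: "n = u + k" by (auto simp: mon_dvd_def)
      have "v + k \<in> ?F"
        using n(1) rees_relations_keys[OF uv(2)] rees_relations_rees_mon[OF P(1) uv(2)]
        by (simp add: k keys_plus_nat rees_mon_add)
      moreover have "lt (v + k) n" unfolding k by (intro add_mono less uv(2))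
      ultimately show False using n(2) irrefl by blast
    qed
    then show ?case by (simp add: uv)
  qed (use n in simp)
  then have "n = m" using standard_mon_unique[OF P _ std] n(1) by blast
  then show ?thesis using n(2)[of m'] total[of m m'] m m' eq by blast
qed

section \<open>The reduced Groebner basis\<close>

definition rees_basis :: "'a set \<Rightarrow> ('a \<times> 'a) set \<Rightarrow> ('a vars, 'k::comm_ring_1) mpoly set"
  where "rees_basis P r = (\<lambda>(u, v). mon_poly u - mon_poly v) ` rees_relations P r"

lemma reduced_groebner_basis_rees_basis:
  fixes P :: "'a set"
  assumes P: "finite P" "partial_order_on P r" and lt: "monomial_order (xyz_vars P r) lt"
    and less: "\<And>u v. (u, v) \<in> rees_relations P r \<Longrightarrow> lt v u"
  shows "reduced_groebner_basis (xyz_vars P r) lt (rees_ideal P r)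
      (rees_basis P r :: ('a vars, 'k::comm_ring_1) mpoly set)"
    and "(u, v) \<in> rees_relations P r \<Longrightarrow> in_mon lt (mon_poly u - mon_poly v :: ('a vars, 'k) mpoly) = u"
proof -
  interpret monomial_order "xyz_vars P r" lt by (fact lt)
  let ?b = "\<lambda>u v. mon_poly u - mon_poly v :: ('a vars, 'k) mpoly"
  let ?W = "rees_ideal P r :: ('a vars, 'k) mpoly set"
  have neq: "u \<noteq> v" if "(u, v) \<in> rees_relations P r" for u v
    using less[OF that] irrefl by blast
  have keys: "Poly_Mapping.keys (?b u v) = {u, v}" if "u \<noteq> v" for u v
    using that by (auto simp: in_keys_iff lookup_minus lookup_mon_poly split: if_splits)
  have in_mon_b: "in_mon lt (?b u v) = u" if "(u, v) \<in> rees_relations P r" for u v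
    using less[OF that] neq[OF that] by (intro in_mon_eqI) (auto simp: keys)
  then show "(u, v) \<in> rees_relations P r \<Longrightarrow> in_mon lt (?b u v) = u" .
  have W: "?W \<subseteq> polys (xyz_vars P r)" by (auto simp: rees_ideal_def)
  have "?b u v \<in> ?W - {0}" if "(u, v) \<in> rees_relations P r" for u v
  proof -
    have "?b u v \<noteq> 0" using keys[OF neq[OF that]] by (metis insert_not_empty keys_zero)
    then show ?thesis
      using rees_relations_keys[OF that] rees_relations_rees_mon[OF P(1) that]
      by (simp add: binomial_in_rees_ideal)
  qed
  then have sub: "rees_basis P r \<subseteq> ?W - {0}" by (auto simp: rees_basis_def)
  have dvd: "\<exists>g\<in>rees_basis P r :: ('a vars, 'k) mpoly set. mon_dvd (in_mon lt g) (in_mon lt f)"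
    if f: "f \<in> ?W - {0}" for f
  proof (rule ccontr)
    assume none: "\<not> ?thesis"
    have f': "f \<in> polys (xyz_vars P r)" "f \<noteq> 0" using f W by auto
    have m: "in_mon lt f \<in> Poly_Mapping.keys f" using f' by (rule in_mon_in_keys)
    have "\<not> mon_dvd u (in_mon lt f)" if "(u, v) \<in> rees_relations P r" for u v
      using none in_mon_b[OF that] that unfolding rees_basis_def by force
    then have std: "standard_mon P r (in_mon lt f)"
      using m f'(1) by (auto simp: standard_mon_def polys_def)
    \<comment> \<open>The kernel condition puts a second monomial of \<open>f\<close> into the fibre
      of \<open>in_mon lt f\<close>. It would lie above that standard monomial by minimality, and
      below it as a non-initial monomial of \<open>f\<close>.\<close>
    obtain m' where m': "m' \<in> Poly_Mapping.keys f" "m' \<noteq> in_mon lt f"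
      "rees_mon P m' = rees_mon P (in_mon lt f)"
      using rees_ideal_fibre[of f P r] f m by blast
    have "Poly_Mapping.keys m' \<subseteq> xyz_vars P r" using m'(1) f'(1) by (simp add: polys_def)
    then have "lt (in_mon lt f) m'"
      using standard_mon_minimal[OF P lt less std] m'(2,3) by blast
    moreover have "lt m' (in_mon lt f)" using less_in_mon[OF f' m'(1,2)] .
    ultimately show False using trans irrefl by blast
  qed
  have "groebner_basis (xyz_vars P r) lt ?W (rees_basis P r)"
    unfolding groebner_basis_iff[OF W] using sub dvd finite_rees_relations[OF P(1), of r]
    by (simp add: rees_basis_def)
  moreover have "Poly_Mapping.lookup g (in_mon lt g) = 1"
    if "g \<in> rees_basis P r" for g :: "('a vars, 'k) mpoly"
  proof -
    obtain u v where g: "(u, v) \<in> rees_relations P r" "g = ?b u v"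
      using \<open>g \<in> rees_basis P r\<close> by (auto simp: rees_basis_def)
    have "v \<noteq> u" using neq[OF g(1)] by blast
    then show ?thesis
      unfolding g(2) in_mon_b[OF g(1)] by (simp add: lookup_minus lookup_mon_poly)
  qed
  moreover have "\<not> mon_dvd (in_mon lt g) m"
    if "g \<in> rees_basis P r" "h \<in> rees_basis P r" "g \<noteq> h" "m \<in> Poly_Mapping.keys h"
    for g h :: "('a vars, 'k) mpoly" and m
  proof -
    obtain u v where g: "(u, v) \<in> rees_relations P r" "g = ?b u v"
      using \<open>g \<in> rees_basis P r\<close> by (auto simp: rees_basis_def)
    obtain u' v' where h: "(u', v') \<in> rees_relations P r" "h = ?b u' v'"
      using \<open>h \<in> rees_basis P r\<close> by (auto simp: rees_basis_def)
    \<comment> \<open>Divisibility of the first term of \<open>h\<close> would force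
      \<open>g = h\<close>; that of the second term never occurs.\<close>
    have "m = u' \<or> m = v'" using that(4) keys[OF neq[OF h(1)]] by (auto simp: h(2))
    then show ?thesis
      using rees_relations_not_dvd[OF g(1) h(1)] rees_relations_unique[OF g(1) h(1)] that(3)
      unfolding g(2) in_mon_b[OF g(1)] h(2) by blast
  qed
  ultimately show "reduced_groebner_basis (xyz_vars P r) lt ?W (rees_basis P r)"
    unfolding reduced_groebner_basis_def by blast
qed

theorem theorem1p1:
  fixes P :: "'a set" and r :: "('a \<times> 'a) set"
    and ps :: "'a list" and Is :: "'a set list"
    and W :: "('a vars, 'k::field) mpoly set"
  assumes poset: "partial_order_on P r"
    and enum_P: "distinct ps" "set ps = P"
    and enum_ideals: "admissible_enum P r Is"
    and W: "W = rees_ideal P r"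
  shows "(\<exists>!G. reduced_groebner_basis (xyz_vars P r) (lex_sharp_less ps Is) W G) \<and>
    (\<forall>G. reduced_groebner_basis (xyz_vars P r) (lex_sharp_less ps Is) W G \<longrightarrow>
      (\<forall>g\<in>G. quadratic_binomial g \<and> squarefree_mon (in_mon (lex_sharp_less ps Is) g)))"
proof -
  let ?lt = "lex_sharp_less ps Is"
  let ?G = "rees_basis P r :: ('a vars, 'k) mpoly set"
  have fin: "finite P" using enum_P(2) by blast
  have order: "monomial_order (xyz_vars P r) ?lt"
    using enum_P(2) enum_ideals by (intro monomial_order_lex_sharp) (simp_all add: admissible_enum_def)
  have less: "?lt v u" if "(u, v) \<in> rees_relations P r" for u v
    using enum_P enum_ideals that by (rule rees_relations_less)
  have G: "reduced_groebner_basis (xyz_vars P r) ?lt W ?G"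
    unfolding W using fin poset order less by (rule reduced_groebner_basis_rees_basis(1))
  have WV: "W \<subseteq> polys (xyz_vars P r)" by (auto simp: W rees_ideal_def)
  have "f - g \<in> W" if "f \<in> W" "g \<in> W" for f g
    using that unfolding W by (rule rees_ideal_diff)
  \<comment> \<open>Two reduced bases are included in each other.\<close>
  then have uniq: "H = ?G" if "reduced_groebner_basis (xyz_vars P r) ?lt W H" for H
    using monomial_order.reduced_groebner_basis_subset[OF order WV _ that G]
      monomial_order.reduced_groebner_basis_subset[OF order WV _ G that] by blast
  have "quadratic_binomial g \<and> squarefree_mon (in_mon ?lt g)" if g: "g \<in> ?G" for g
  proof -
    obtain u v where uv: "(u, v) \<in> rees_relations P r" "g = mon_poly u - mon_poly v"
      using g by (auto simp: rees_basis_def)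
    have "u \<noteq> v" using less[OF uv(1)] monomial_order.irrefl[OF order] by metis
    then have "quadratic_binomial g"
      using rees_relations_deg[OF uv(1)] uv(2) unfolding quadratic_binomial_def by blast
    moreover have "in_mon ?lt g = u"
      unfolding uv(2) using fin poset order less uv(1) by (rule reduced_groebner_basis_rees_basis(2))
    ultimately show ?thesis using rees_relations_squarefree[OF uv(1)] by simp
  qed
  then show ?thesis using G uniq by blast
qed

end
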